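(* Let $K$ be a field of characteristic zero and $n\geq 2$. Then: (1) $P_n/K$ is a simple $G_n$-module with $\mathrm{End}_{G_n}(P_n/K)\simeq K$. (2) The divergence map induces an isomorphism of $G_n$-modules $D_n/\mathfrak{div}_n^c\simeq P_n/K$. (3) $D_n/\mathfrak{div}_n^c$ is a simple $G_n$-module with $\mathrm{End}_{G_n}(D_n/\mathfrak{div}_n^c)\simeq K$.
   Context: $P_n=K[x_1,\ldots,x_n]$, $G_n=\mathrm{Aut}_{K\text{-alg}}(P_n)$, $\partial_i=\partial/\partial x_i$, $D_n=\mathrm{Der}_K(P_n)=\bigoplus_{i=1}^n P_n\partial_i$. For $\partial=\sum_{i=1}^n a_i\partial_i\in D_n$, $\mathrm{div}(\partial)=\sum_{i=1}^n \partial a_i/\partial x_i$, and $\mathfrak{div}_n^c=\{\partial\in D_n : \mathrm{div}(\partial)\in K\}$. The group $G_n$ acts naturally on $P_n$ (preserving $K$) and on $D_n$ by $\sigma(\partial)=\sigma\partial\sigma^{-1}$ (preserving $\mathfrak{div}_n^c$). $G_n$-modules are $K$-linear representations of $G_n$; $\mathrm{End}_{G_n}$ denotes $K$-linear endomorphisms commuting with $G_n$. *)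

theory Defs
  imports
    "HOL-Algebra.Algebraic_Closure_Type"
    "HOL-Library.Poly_Mapping"
    "HOL-Library.Cardinality"
begin

hide_const (open) Polynomial.smult Polynomial.pderiv

section \<open>Linear representations of a group\<close>

record ('g, 'a, 'b) gmodule = "('a, 'b) module" +
  gact :: "'g \<Rightarrow> 'b \<Rightarrow> 'b"

text \<open>The ring multiplication and unit that the record inherits from the library's module
  record play no role.\<close>

locale gmodule = module R M + G: group G
  for R :: "('a, 'r) ring_scheme" and G :: "('g, 's) monoid_scheme"
    and M :: "('g, 'a, 'b, 't) gmodule_scheme" +
  assumes gact_closed:
      "\<lbrakk>g \<in> carrier G; x \<in> carrier M\<rbrakk> \<Longrightarrow> gact M g x \<in> carrier M"
    and gact_one: "x \<in> carrier M \<Longrightarrow> gact M \<one>\<^bsub>G\<^esub> x = x"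
    and gact_mult:
      "\<lbrakk>g \<in> carrier G; h \<in> carrier G; x \<in> carrier M\<rbrakk> \<Longrightarrow>
        gact M (g \<otimes>\<^bsub>G\<^esub> h) x = gact M g (gact M h x)"
    and gact_add:
      "\<lbrakk>g \<in> carrier G; x \<in> carrier M; y \<in> carrier M\<rbrakk> \<Longrightarrow>
        gact M g (x \<oplus>\<^bsub>M\<^esub> y) = gact M g x \<oplus>\<^bsub>M\<^esub> gact M g y"
    and gact_smult:
      "\<lbrakk>g \<in> carrier G; a \<in> carrier R; x \<in> carrier M\<rbrakk> \<Longrightarrow>
        gact M g (a \<odot>\<^bsub>M\<^esub> x) = a \<odot>\<^bsub>M\<^esub> gact M g x"

definition gsubmodule ::
  "('a, 'r) ring_scheme \<Rightarrow> ('g, 's) monoid_scheme \<Rightarrow> ('g, 'a, 'b, 't) gmodule_scheme \<Rightarrow>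
    'b set \<Rightarrow> bool"
  where "gsubmodule R G M N \<longleftrightarrow>
    submodule N R M \<and> (\<forall>g\<in>carrier G. \<forall>x\<in>N. gact M g x \<in> N)"

locale simple_gmodule = gmodule R G M
  for R :: "('a, 'r) ring_scheme" and G :: "('g, 's) monoid_scheme"
    and M :: "('g, 'a, 'b, 't) gmodule_scheme" +
  assumes nonzero: "carrier M \<noteq> {\<zero>\<^bsub>M\<^esub>}"
    and only_trivial:
      "gsubmodule R G M N \<Longrightarrow> N = {\<zero>\<^bsub>M\<^esub>} \<or> N = carrier M"

definition quotient_gmodule ::
  "('g, 'a, 'b, 't) gmodule_scheme \<Rightarrow> 'b set \<Rightarrow> ('g, 'a, 'b set) gmodule"
  where "quotient_gmodule M N =
    \<lparr>carrier = a_rcosets\<^bsub>M\<^esub> N, monoid.mult = undefined, one = undefined,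
     ring.zero = N, add = set_add M,
     smult = (\<lambda>a C. \<Union>x\<in>C. N +>\<^bsub>M\<^esub> (a \<odot>\<^bsub>M\<^esub> x)),
     gact = (\<lambda>g C. \<Union>x\<in>C. N +>\<^bsub>M\<^esub> gact M g x)\<rparr>"

definition gmodule_hom ::
  "('a, 'r) ring_scheme \<Rightarrow> ('g, 's) monoid_scheme \<Rightarrow> ('g, 'a, 'b, 't) gmodule_scheme \<Rightarrow>
    ('g, 'a, 'c, 'u) gmodule_scheme \<Rightarrow> ('b \<Rightarrow> 'c) set"
  where "gmodule_hom R G M N =
    {f \<in> hom (add_monoid M) (add_monoid N).
      (\<forall>a\<in>carrier R. \<forall>x\<in>carrier M. f (a \<odot>\<^bsub>M\<^esub> x) = a \<odot>\<^bsub>N\<^esub> f x) \<and>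
      (\<forall>g\<in>carrier G. \<forall>x\<in>carrier M. f (gact M g x) = gact N g (f x))}"

definition gmodule_iso ::
  "('a, 'r) ring_scheme \<Rightarrow> ('g, 's) monoid_scheme \<Rightarrow> ('g, 'a, 'b, 't) gmodule_scheme \<Rightarrow>
    ('g, 'a, 'c, 'u) gmodule_scheme \<Rightarrow> ('b \<Rightarrow> 'c) set"
  where "gmodule_iso R G M N =
    {f \<in> gmodule_hom R G M N. bij_betw f (carrier M) (carrier N)}"

text \<open>Endomorphisms are taken extensional, so that each of them is represented by exactly
  one function.\<close>

definition gmodule_End ::
  "('a, 'r) ring_scheme \<Rightarrow> ('g, 's) monoid_scheme \<Rightarrow> ('g, 'a, 'b, 't) gmodule_scheme \<Rightarrow>
    ('a, 'b \<Rightarrow> 'b) module"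
  where "gmodule_End R G M =
    \<lparr>carrier = gmodule_hom R G M M \<inter> extensional (carrier M),
     monoid.mult = compose (carrier M), one = (\<lambda>x\<in>carrier M. x),
     ring.zero = (\<lambda>x\<in>carrier M. \<zero>\<^bsub>M\<^esub>), add = (\<lambda>f g. \<lambda>x\<in>carrier M. f x \<oplus>\<^bsub>M\<^esub> g x),
     smult = (\<lambda>a f. \<lambda>x\<in>carrier M. a \<odot>\<^bsub>M\<^esub> f x)\<rparr>"

definition ring_as_algebra :: "('a, 'r) ring_scheme \<Rightarrow> ('a, 'a) module"
  where "ring_as_algebra R =
    \<lparr>carrier = carrier R, monoid.mult = monoid.mult R, one = one R,
     ring.zero = ring.zero R, add = add R, smult = monoid.mult R\<rparr>"

definition algebra_isomorphic ::
  "('a, 'r) ring_scheme \<Rightarrow> ('a, 'b, 't) module_scheme \<Rightarrow> ('a, 'c, 'u) module_scheme \<Rightarrow> bool"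
  where "algebra_isomorphic R A B \<longleftrightarrow>
    (\<exists>h\<in>ring_iso A B. \<forall>a\<in>carrier R. \<forall>x\<in>carrier A. h (a \<odot>\<^bsub>A\<^esub> x) = a \<odot>\<^bsub>B\<^esub> h x)"


section \<open>Polynomials, automorphisms and derivations\<close>

text \<open>The variables are indexed by a finite type, whose cardinality is the number n of
  variables; a monomial is its exponent vector.\<close>

type_synonym ('n, 'k) mpoly = "('n \<Rightarrow>\<^sub>0 nat) \<Rightarrow>\<^sub>0 'k"
type_synonym ('n, 'k) mpoly_map = "('n, 'k) mpoly \<Rightarrow> ('n, 'k) mpoly"

definition Const :: "'k \<Rightarrow> ('n, 'k::field) mpoly"
  where "Const c = Poly_Mapping.single 0 c"

definition Var :: "'n \<Rightarrow> ('n, 'k::field) mpoly"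
  where "Var i = Poly_Mapping.single (Poly_Mapping.single i 1) 1"

text \<open>If the variable does not occur in a monomial, the truncated subtraction is harmless
  because the coefficient vanishes.\<close>

definition pderiv :: "'n \<Rightarrow> ('n, 'k::field) mpoly_map"
  where "pderiv i p = (\<Sum>m\<in>Poly_Mapping.keys p.
    Poly_Mapping.single (m - Poly_Mapping.single i 1)
      (of_nat (Poly_Mapping.lookup m i) * Poly_Mapping.lookup p m))"

definition poly_Aut :: "('n, 'k::field) mpoly_map monoid"
  where "poly_Aut =
    \<lparr>carrier = {\<sigma>. bij \<sigma> \<and> (\<forall>p q. \<sigma> (p + q) = \<sigma> p + \<sigma> q) \<and>
       (\<forall>p q. \<sigma> (p * q) = \<sigma> p * \<sigma> q) \<and> (\<forall>c. \<sigma> (Const c) = Const c)},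
     monoid.mult = (\<circ>), one = id\<rparr>"

definition poly_Der :: "('n, 'k::field) mpoly_map set"
  where "poly_Der = {\<delta>. (\<forall>p q. \<delta> (p + q) = \<delta> p + \<delta> q) \<and>
    (\<forall>c p. \<delta> (Const c * p) = Const c * \<delta> p) \<and>
    (\<forall>p q. \<delta> (p * q) = \<delta> p * q + p * \<delta> q)}"

definition Der_coeffs :: "('n::finite, 'k::field) mpoly_map \<Rightarrow> 'n \<Rightarrow> ('n, 'k) mpoly"
  where "Der_coeffs \<delta> = (THE a. \<delta> = (\<lambda>p. \<Sum>i\<in>UNIV. a i * pderiv i p))"

definition divergence :: "('n::finite, 'k::field) mpoly_map \<Rightarrow> ('n, 'k) mpoly"
  where "divergence \<delta> = (\<Sum>i\<in>UNIV. pderiv i (Der_coeffs \<delta> i))"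

definition const_div_Der :: "('n::finite, 'k::field) mpoly_map set"
  where "const_div_Der = {\<delta> \<in> poly_Der. divergence \<delta> \<in> range Const}"

lemma pderiv_Var:
  "pderiv i (Var j :: ('n, 'k::field) mpoly) = (if i = j then 1 else 0)"
proof -
  have "Poly_Mapping.keys (Var j :: ('n, 'k) mpoly) = {Poly_Mapping.single j 1}"
    by (simp add: Var_def)
  then have "pderiv i (Var j :: ('n, 'k) mpoly) =
      Poly_Mapping.single (Poly_Mapping.single j 1 - Poly_Mapping.single i 1)
        (of_nat (Poly_Mapping.lookup (Poly_Mapping.single j 1) i))"
    unfolding pderiv_def by (simp add: Var_def)
  then show ?thesis
    by (auto simp: lookup_single when_def single_one)
qed

lemma Der_coeffs_unique:
  fixes a :: "'n::finite \<Rightarrow> ('n, 'k::field) mpoly"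
  shows "Der_coeffs (\<lambda>p. \<Sum>i\<in>UNIV. a i * pderiv i p) = a"
proof -
  have eval: "(\<Sum>i\<in>UNIV. b i * pderiv i (Var j)) = b j"
    for b :: "'n \<Rightarrow> ('n, 'k) mpoly" and j
  proof -
    have "(\<Sum>i\<in>UNIV. b i * pderiv i (Var j)) = (\<Sum>i\<in>UNIV. if i = j then b i else 0)"
      by (rule sum.cong) (auto simp: pderiv_Var)
    then show ?thesis by simp
  qed
  show ?thesis
    unfolding Der_coeffs_def
  proof (rule the_equality)
    fix b
    assume "(\<lambda>p. \<Sum>i\<in>UNIV. a i * pderiv i p) = (\<lambda>p. \<Sum>i\<in>UNIV. b i * pderiv i p)"
    then have "a j = b j" for j
      using fun_cong[of _ _ "Var j"] eval[of a j] eval[of b j] by metis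
    then show "b = a" by (intro ext) simp
  qed (rule refl)
qed


section \<open>The two representations and their quotients\<close>

definition poly_rep :: "(('n, 'k::field) mpoly_map, 'k, ('n, 'k) mpoly) gmodule"
  where "poly_rep =
    \<lparr>carrier = UNIV, monoid.mult = (*), one = 1, ring.zero = 0, add = (+),
     smult = (\<lambda>c p. Const c * p), gact = (\<lambda>\<sigma> p. \<sigma> p)\<rparr>"

definition Der_rep :: "(('n, 'k::field) mpoly_map, 'k, ('n, 'k) mpoly_map) gmodule"
  where "Der_rep =
    \<lparr>carrier = poly_Der, monoid.mult = undefined, one = undefined,
     ring.zero = (\<lambda>p. 0), add = (\<lambda>\<delta> \<epsilon> p. \<delta> p + \<epsilon> p),
     smult = (\<lambda>c \<delta> p. Const c * \<delta> p), gact = (\<lambda>\<sigma> \<delta>. \<sigma> \<circ> \<delta> \<circ> inv_into UNIV \<sigma>)\<rparr>"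

type_synonym ('n, 'k) poly_quotient =
  "(('n, 'k) mpoly_map, 'k, ('n, 'k) mpoly set) gmodule"
type_synonym ('n, 'k) Der_quotient =
  "(('n, 'k) mpoly_map, 'k, ('n, 'k) mpoly_map set) gmodule"

definition poly_mod_const :: "('n, 'k::field) poly_quotient"
  where "poly_mod_const = quotient_gmodule poly_rep (range Const)"

definition Der_mod_const_div :: "('n::finite, 'k::field) Der_quotient"
  where "Der_mod_const_div = quotient_gmodule Der_rep const_div_Der"

abbreviation base_field :: "'k::field ring"
  where "base_field \<equiv> ring_of_type_algebra"

end

theory Submission
  imports Defs "HOL-Analysis.Determinants"
begin

text \<open>The shears \<open>x\<^sub>i \<mapsto> x\<^sub>i + c q\<close>, with \<open>q\<close> a monomial free of \<open>x\<^sub>i\<close>, expand as polynomials in \<open>c\<close>, so over an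
  infinite field every \<open>G\<^sub>n\<close>-submodule of \<open>P\<^sub>n\<close> is stable under the derivations \<open>q \<partial>\<^sub>i\<close>. Lowering degrees
  with the \<open>\<partial>\<^sub>i\<close> one reaches a nonconstant linear form, from which the \<open>q \<partial>\<^sub>i\<close> generate all monomials when
  \<open>n \<ge> 2\<close>; this makes \<open>P\<^sub>n/K\<close> simple. The class of a variable is determined up to scalars by the shears
  fixing it, so it is an eigenvector of every equivariant endomorphism, which is then a scalar by Schur's
  argument. The divergence is surjective, and it is equivariant because the Jacobian determinant of an
  automorphism is a unit, hence a constant; so everything transports to \<open>D\<^sub>n/div\<^sub>n\<^sup>c\<close>.\<close>

section \<open>Quotients, isomorphisms and endomorphisms of representations\<close>

text \<open>Since \<open>K\<close> need not be algebraically closed, Schur's lemma alone would only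
  give a division algebra; exhibiting one eigenvector, the class of a variable, is what forces
  endomorphisms to be scalars. The monomial \<open>q\<close> is kept free of \<open>x_i\<close> so
  that the shear is invertible, with inverse given by \<open>- c\<close>; with a single variable
  only translations would be left and degrees could never be raised, which is where the second
  variable enters. Characteristic zero is used three times: the scalars \<open>2 ^ k - 2 ^ n\<close>
  that separate the coefficients of a shear expansion are nonzero, a polynomial whose partial
  derivatives all vanish is constant, and antiderivatives exist. For the divergence it suffices to
  treat the conjugates of the \<open>\<partial>\<^sub>j\<close>: they are the partial derivatives in
  the new coordinates, so they commute with each other, and this lets Jacobi's formula apply without
  second derivatives of the inverse automorphism.\<close>

context gmodule
begin

lemma gmodule: "gmodule R G M"
  by (rule gmodule_axioms)

text \<open>Closure under negatives, which \<open>submodule\<close> demands, comes from the scalar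
  -1.\<close>

lemma gsubmoduleI:
  assumes "N \<subseteq> carrier M" "\<zero>\<^bsub>M\<^esub> \<in> N"
    and "\<And>x y. x \<in> N \<Longrightarrow> y \<in> N \<Longrightarrow> x \<oplus>\<^bsub>M\<^esub> y \<in> N"
    and smult: "\<And>a x. a \<in> carrier R \<Longrightarrow> x \<in> N \<Longrightarrow> a \<odot>\<^bsub>M\<^esub> x \<in> N"
    and "\<And>g x. g \<in> carrier G \<Longrightarrow> x \<in> N \<Longrightarrow> gact M g x \<in> N"
  shows "gsubmodule R G M N"
proof -
  have "\<ominus>\<^bsub>M\<^esub> x \<in> N" if "x \<in> N" for x
  proof -
    have "\<ominus>\<^bsub>M\<^esub> x = (\<ominus>\<^bsub>R\<^esub> \<one>\<^bsub>R\<^esub>) \<odot>\<^bsub>M\<^esub> x"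
      using that assms(1) by (simp add: smult_l_minus subset_iff)
    then show ?thesis
      using smult[of "\<ominus>\<^bsub>R\<^esub> \<one>\<^bsub>R\<^esub>" x] that by simp
  qed
  then show ?thesis
    unfolding gsubmodule_def using assms by (auto intro: submoduleI)
qed

lemma gsubmodule_abelian_subgroup:
  "gsubmodule R G M N \<Longrightarrow> abelian_subgroup N M"
  unfolding gsubmodule_def submodule_def
  by (auto intro!: abelian_subgroupI3 additive_subgroup.intro M.abelian_group_axioms)

context
  fixes N assumes N: "gsubmodule R G M N"
begin

interpretation N: abelian_subgroup N M
  using N by (rule gsubmodule_abelian_subgroup)

lemma gsubmodule_smult: "a \<in> carrier R \<Longrightarrow> x \<in> N \<Longrightarrow> a \<odot>\<^bsub>M\<^esub> x \<in> N"
  using N unfolding gsubmodule_def by (auto dest: submodule.smult_closed)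

lemma gsubmodule_gact: "g \<in> carrier G \<Longrightarrow> x \<in> N \<Longrightarrow> gact M g x \<in> N"
  using N unfolding gsubmodule_def by auto

lemma mem_coset_iff:
  assumes "x \<in> carrier M"
  shows "y \<in> N +>\<^bsub>M\<^esub> x \<longleftrightarrow> (\<exists>h\<in>N. y = h \<oplus>\<^bsub>M\<^esub> x)"
  by (auto simp: a_r_coset_def')

lemma coset_eq_iff:
  assumes "x \<in> carrier M" "y \<in> carrier M"
  shows "N +>\<^bsub>M\<^esub> x = N +>\<^bsub>M\<^esub> y \<longleftrightarrow> x \<ominus>\<^bsub>M\<^esub> y \<in> N"
proof
  assume "N +>\<^bsub>M\<^esub> x = N +>\<^bsub>M\<^esub> y"
  then obtain h where h: "h \<in> N" "x = h \<oplus>\<^bsub>M\<^esub> y"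
    using N.a_rcos_self[OF assms(1)] mem_coset_iff[OF assms(2)] by auto
  have "x \<ominus>\<^bsub>M\<^esub> y = h"
    using h assms by (simp add: M.minus_eq M.a_assoc M.r_neg)
  with h show "x \<ominus>\<^bsub>M\<^esub> y \<in> N" by simp
next
  assume *: "x \<ominus>\<^bsub>M\<^esub> y \<in> N"
  have "x = (x \<ominus>\<^bsub>M\<^esub> y) \<oplus>\<^bsub>M\<^esub> y"
    using assms by (simp add: M.minus_eq M.a_assoc M.l_neg)
  then have "x \<in> N +>\<^bsub>M\<^esub> y"
    using * mem_coset_iff[OF assms(2)] by auto
  then show "N +>\<^bsub>M\<^esub> x = N +>\<^bsub>M\<^esub> y"
    using M.a_repr_independence N.a_subgroup assms by metis
qed

lemma coset_eq_self_iff: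
  assumes "x \<in> carrier M"
  shows "N +>\<^bsub>M\<^esub> x = N \<longleftrightarrow> x \<in> N"
  using assms by (metis M.a_coset_join1 M.a_coset_join2 N.a_subgroup N.a_Hcarr)

text \<open>The operations of \<open>quotient_gmodule\<close> are unions over all representatives of
  a coset. An additive map preserving \<open>N\<close> sends all representatives to one coset, so
  the union collapses; this serves both the scalar action and the group action.\<close>

lemma coset_lift:
  assumes f: "\<And>x. x \<in> carrier M \<Longrightarrow> f x \<in> carrier M"
    and add: "\<And>x y. x \<in> carrier M \<Longrightarrow> y \<in> carrier M \<Longrightarrow> f (x \<oplus>\<^bsub>M\<^esub> y) = f x \<oplus>\<^bsub>M\<^esub> f y"
    and fN: "\<And>x. x \<in> N \<Longrightarrow> f x \<in> N"
    and x: "x \<in> carrier M"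
  shows "(\<Union>y\<in>N +>\<^bsub>M\<^esub> x. N +>\<^bsub>M\<^esub> f y) = N +>\<^bsub>M\<^esub> f x"
proof -
  have "N +>\<^bsub>M\<^esub> f y = N +>\<^bsub>M\<^esub> f x" if "y \<in> N +>\<^bsub>M\<^esub> x" for y
  proof -
    from that obtain h where h: "h \<in> N" "y = h \<oplus>\<^bsub>M\<^esub> x"
      using mem_coset_iff[OF x] by auto
    have hM: "h \<in> carrier M" using h(1) by (rule N.a_Hcarr)
    have "f y \<ominus>\<^bsub>M\<^esub> f x = f h"
      using h hM x f by (simp add: add M.minus_eq M.a_assoc M.r_neg)
    moreover have "y \<in> carrier M" using h hM x by simp
    ultimately show ?thesis
      using coset_eq_iff f x fN h by metis
  qed
  then show ?thesis
    using N.a_rcos_self[OF x] by blast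
qed

lemma quotient_carrier: "carrier (quotient_gmodule M N) = (\<lambda>x. N +>\<^bsub>M\<^esub> x) ` carrier M"
  unfolding quotient_gmodule_def by (auto simp: A_RCOSETS_def')

lemma quotient_zero: "\<zero>\<^bsub>quotient_gmodule M N\<^esub> = N"
  unfolding quotient_gmodule_def by simp

lemma quotient_add:
  "\<lbrakk>x \<in> carrier M; y \<in> carrier M\<rbrakk> \<Longrightarrow>
    (N +>\<^bsub>M\<^esub> x) \<oplus>\<^bsub>quotient_gmodule M N\<^esub> (N +>\<^bsub>M\<^esub> y) = N +>\<^bsub>M\<^esub> (x \<oplus>\<^bsub>M\<^esub> y)"
  unfolding quotient_gmodule_def by (simp add: N.a_rcos_sum)

lemma quotient_smult:
  "\<lbrakk>a \<in> carrier R; x \<in> carrier M\<rbrakk> \<Longrightarrow>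
    a \<odot>\<^bsub>quotient_gmodule M N\<^esub> (N +>\<^bsub>M\<^esub> x) = N +>\<^bsub>M\<^esub> (a \<odot>\<^bsub>M\<^esub> x)"
  unfolding quotient_gmodule_def
  by (simp add: coset_lift smult_r_distr gsubmodule_smult)

lemma quotient_gact:
  "\<lbrakk>g \<in> carrier G; x \<in> carrier M\<rbrakk> \<Longrightarrow>
    gact (quotient_gmodule M N) g (N +>\<^bsub>M\<^esub> x) = N +>\<^bsub>M\<^esub> gact M g x"
  unfolding quotient_gmodule_def
  by (simp add: coset_lift gact_closed gact_add gsubmodule_gact)

lemma N_eq_coset_zero: "N = N +>\<^bsub>M\<^esub> \<zero>\<^bsub>M\<^esub>"
  by (rule sym, subst coset_eq_self_iff) simp_all

lemma gmodule_quotient: "gmodule R G (quotient_gmodule M N)"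
proof -
  let ?Q = "quotient_gmodule M N"
  note [simp] = quotient_carrier quotient_zero quotient_add quotient_smult quotient_gact
  have zero: "N +>\<^bsub>M\<^esub> \<zero>\<^bsub>M\<^esub> = N"
    by (rule N_eq_coset_zero[symmetric])
  have add0: "N \<oplus>\<^bsub>?Q\<^esub> (N +>\<^bsub>M\<^esub> x) = N +>\<^bsub>M\<^esub> x" if "x \<in> carrier M" for x
    using quotient_add[of "\<zero>\<^bsub>M\<^esub>" x] that zero by simp
  have inv: "(N +>\<^bsub>M\<^esub> (\<ominus>\<^bsub>M\<^esub> x)) \<oplus>\<^bsub>?Q\<^esub> (N +>\<^bsub>M\<^esub> x) = N" if "x \<in> carrier M" for x
    using that zero by (simp add: M.l_neg)
  have "abelian_group ?Q"
  proof (rule abelian_groupI)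
    fix C assume "C \<in> carrier ?Q"
    then obtain x where x: "x \<in> carrier M" "C = N +>\<^bsub>M\<^esub> x" by auto
    then show "\<exists>y\<in>carrier ?Q. y \<oplus>\<^bsub>?Q\<^esub> C = \<zero>\<^bsub>?Q\<^esub>"
      using inv[of x] by (auto intro!: bexI[of _ "\<ominus>\<^bsub>M\<^esub> x"])
  next
    show "\<zero>\<^bsub>?Q\<^esub> \<in> carrier ?Q" using N_eq_coset_zero by auto
  qed (auto simp: add0 M.a_ac)
  then have "module R ?Q"
    by (intro moduleI R.is_cring)
      (auto simp: smult_l_distr smult_r_distr smult_assoc1)
  then show ?thesis
    by (intro gmodule.intro gmodule_axioms.intro G.is_group)
      (auto simp: gact_closed gact_one gact_mult gact_add gact_smult)
qed

text \<open>Correspondence theorem: a submodule of the quotient pulls back to a submodule of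
  \<open>M\<close> containing \<open>N\<close>, so maximality of \<open>N\<close> leaves only the
  two trivial ones.\<close>

lemma simple_quotientI:
  assumes ne: "N \<noteq> carrier M"
    and max: "\<And>V. gsubmodule R G M V \<Longrightarrow> N \<subseteq> V \<Longrightarrow> V \<noteq> N \<Longrightarrow> V = carrier M"
  shows "simple_gmodule R G (quotient_gmodule M N)"
proof -
  let ?Q = "quotient_gmodule M N"
  interpret Q: gmodule R G ?Q by (rule gmodule_quotient)
  show ?thesis
  proof (intro simple_gmodule.intro simple_gmodule_axioms.intro Q.gmodule)
    obtain x where x: "x \<in> carrier M" "x \<notin> N"
      using ne N.a_subset by blast
    then have "N +>\<^bsub>M\<^esub> x \<noteq> N" using coset_eq_self_iff by simp
    with x show "carrier ?Q \<noteq> {\<zero>\<^bsub>?Q\<^esub>}"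
      by (auto simp: quotient_carrier quotient_zero)
  next
    fix S assume S: "gsubmodule R G ?Q S"
    interpret S: abelian_subgroup S ?Q
      using S by (rule Q.gsubmodule_abelian_subgroup)
    define V where "V = {x \<in> carrier M. N +>\<^bsub>M\<^esub> x \<in> S}"
    have NS: "N \<in> S" using S.zero_closed by (simp add: quotient_zero)
    have SV: "S = (\<lambda>x. N +>\<^bsub>M\<^esub> x) ` V"
      using S.a_subset by (auto simp: V_def quotient_carrier)
    have V: "gsubmodule R G M V"
    proof (rule gsubmoduleI)
      show "\<zero>\<^bsub>M\<^esub> \<in> V"
        using NS N_eq_coset_zero by (simp add: V_def)
      show "x \<oplus>\<^bsub>M\<^esub> y \<in> V" if "x \<in> V" "y \<in> V" for x y
        using that S.a_closed[of "N +>\<^bsub>M\<^esub> x" "N +>\<^bsub>M\<^esub> y"] by (simp add: V_def quotient_add)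
      show "a \<odot>\<^bsub>M\<^esub> x \<in> V" if "a \<in> carrier R" "x \<in> V" for a x
        using that Q.gsubmodule_smult[OF S, of a "N +>\<^bsub>M\<^esub> x"] by (simp add: V_def quotient_smult)
      show "gact M g x \<in> V" if "g \<in> carrier G" "x \<in> V" for g x
        using that Q.gsubmodule_gact[OF S, of g "N +>\<^bsub>M\<^esub> x"]
        by (simp add: V_def quotient_gact gact_closed)
    qed (auto simp: V_def)
    have NV: "N \<subseteq> V"
    proof
      fix x assume x: "x \<in> N"
      then have "x \<in> carrier M" by (rule N.a_Hcarr)
      then have "N +>\<^bsub>M\<^esub> x = N" using coset_eq_self_iff x by simp
      with \<open>x \<in> carrier M\<close> NS show "x \<in> V" by (simp add: V_def)
    qed
    show "S = {\<zero>\<^bsub>?Q\<^esub>} \<or> S = carrier ?Q"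
    proof (cases "V = N")
      case True
      then have "S \<subseteq> {N}"
        using SV coset_eq_self_iff N.a_subset by auto
      then show ?thesis using NS by (auto simp: quotient_zero)
    next
      case False
      then show ?thesis
        using max[OF V NV] SV by (simp add: quotient_carrier)
    qed
  qed
qed

end

end

section \<open>Equivariant maps: transport along isomorphisms, quotient maps and Schur's
  argument\<close>

lemma gmodule_homI:
  assumes "\<And>x. x \<in> carrier M \<Longrightarrow> f x \<in> carrier N"
    and "\<And>x y. x \<in> carrier M \<Longrightarrow> y \<in> carrier M \<Longrightarrow> f (x \<oplus>\<^bsub>M\<^esub> y) = f x \<oplus>\<^bsub>N\<^esub> f y"
    and "\<And>a x. a \<in> carrier R \<Longrightarrow> x \<in> carrier M \<Longrightarrow> f (a \<odot>\<^bsub>M\<^esub> x) = a \<odot>\<^bsub>N\<^esub> f x"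
    and "\<And>g x. g \<in> carrier G \<Longrightarrow> x \<in> carrier M \<Longrightarrow> f (gact M g x) = gact N g (f x)"
  shows "f \<in> gmodule_hom R G M N"
  using assms unfolding gmodule_hom_def by (auto simp: hom_def)

lemma gmodule_homD:
  assumes "f \<in> gmodule_hom R G M N"
  shows "\<And>x. x \<in> carrier M \<Longrightarrow> f x \<in> carrier N"
    and "\<And>x y. x \<in> carrier M \<Longrightarrow> y \<in> carrier M \<Longrightarrow> f (x \<oplus>\<^bsub>M\<^esub> y) = f x \<oplus>\<^bsub>N\<^esub> f y"
    and "\<And>a x. a \<in> carrier R \<Longrightarrow> x \<in> carrier M \<Longrightarrow> f (a \<odot>\<^bsub>M\<^esub> x) = a \<odot>\<^bsub>N\<^esub> f x"
    and "\<And>g x. g \<in> carrier G \<Longrightarrow> x \<in> carrier M \<Longrightarrow> f (gact M g x) = gact N g (f x)"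
  using assms unfolding gmodule_hom_def by (auto simp: hom_def)

lemma gmodule_hom_zero:
  assumes "gmodule R G M" "gmodule R G N" "f \<in> gmodule_hom R G M N"
  shows "f \<zero>\<^bsub>M\<^esub> = \<zero>\<^bsub>N\<^esub>"
proof -
  interpret M: gmodule R G M by fact
  interpret N: gmodule R G N by fact
  have "f (\<zero>\<^bsub>R\<^esub> \<odot>\<^bsub>M\<^esub> \<zero>\<^bsub>M\<^esub>) = \<zero>\<^bsub>R\<^esub> \<odot>\<^bsub>N\<^esub> f \<zero>\<^bsub>M\<^esub>"
    by (rule gmodule_homD(3)[OF assms(3)]) simp_all
  then show ?thesis
    using gmodule_homD(1)[OF assms(3), of "\<zero>\<^bsub>M\<^esub>"] by simp
qed

lemma gmodule_hom_comp:
  assumes "f \<in> gmodule_hom R G L M" "h \<in> gmodule_hom R G M N"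
  shows "h \<circ> f \<in> gmodule_hom R G L N"
  using gmodule_homD[OF assms(1)] gmodule_homD[OF assms(2)]
  by (intro gmodule_homI) auto

lemma gmodule_iso_inv:
  assumes "gmodule R G M" "f \<in> gmodule_iso R G M N"
  shows "inv_into (carrier M) f \<in> gmodule_iso R G N M"
proof -
  interpret M: gmodule R G M by fact
  let ?h = "inv_into (carrier M) f"
  from assms have f: "f \<in> gmodule_hom R G M N" and b: "bij_betw f (carrier M) (carrier N)"
    by (auto simp: gmodule_iso_def)
  note fD = gmodule_homD[OF f]
  have inj: "inj_on f (carrier M)" and img: "carrier N = f ` carrier M"
    using b by (auto simp: bij_betw_def)
  have h: "?h (f x) = x" if "x \<in> carrier M" for x
    using inj that by simp
  have "?h \<in> gmodule_hom R G N M"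
  proof (rule gmodule_homI)
    fix g y assume "g \<in> carrier G" "y \<in> carrier N"
    then obtain x where "x \<in> carrier M" "y = f x" using img by auto
    then show "?h (gact N g y) = gact M g (?h y)"
      using \<open>g \<in> carrier G\<close> by (simp add: h fD(4)[symmetric] M.gact_closed)
  qed (auto simp: img h fD(2,3)[symmetric])
  then show ?thesis
    using bij_betw_inv_into[OF b] by (simp add: gmodule_iso_def)
qed

lemma simple_gmodule_iso:
  assumes M: "gmodule R G M" and N: "simple_gmodule R G N" and f: "f \<in> gmodule_iso R G M N"
  shows "simple_gmodule R G M"
proof -
  interpret M: gmodule R G M by fact
  interpret N: simple_gmodule R G N by fact
  from f have fh: "f \<in> gmodule_hom R G M N" and b: "bij_betw f (carrier M) (carrier N)"
    by (auto simp: gmodule_iso_def)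
  note fD = gmodule_homD[OF fh]
  have f0: "f \<zero>\<^bsub>M\<^esub> = \<zero>\<^bsub>N\<^esub>"
    using gmodule_hom_zero[OF M N.gmodule fh] .
  have inj: "inj_on f (carrier M)" and img: "f ` carrier M = carrier N"
    using b by (auto simp: bij_betw_def)
  show ?thesis
  proof (intro simple_gmodule.intro simple_gmodule_axioms.intro M)
    show "carrier M \<noteq> {\<zero>\<^bsub>M\<^esub>}"
      using N.nonzero img f0 by auto
  next
    fix S assume S: "gsubmodule R G M S"
    interpret S: abelian_subgroup S M
      using S by (rule M.gsubmodule_abelian_subgroup)
    have SM: "x \<in> carrier M" if "x \<in> S" for x using that by (rule S.a_Hcarr)
    have "gsubmodule R G N (f ` S)"
      by (rule N.gsubmoduleI)
        (use SM S.zero_closed in \<open>auto simp: fD(1) fD(2-4)[symmetric] f0[symmetric] M.gsubmodule_smult[OF S] M.gsubmodule_gact[OF S]\<close>)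
    then have "f ` S = {\<zero>\<^bsub>N\<^esub>} \<or> f ` S = carrier N"
      by (rule N.only_trivial)
    then have "f ` S = f ` {\<zero>\<^bsub>M\<^esub>} \<or> f ` S = f ` carrier M"
      using f0 img by simp
    then show "S = {\<zero>\<^bsub>M\<^esub>} \<or> S = carrier M"
      using S.a_subset inj by (metis M.M.zero_closed empty_subsetI inj_on_image_eq_iff insert_subset order_refl)
  qed
qed

lemma gmodule_quotient_iso:
  assumes M: "gmodule R G M" and M': "gmodule R G M'" and N': "gsubmodule R G M' N'"
    and f: "f \<in> gmodule_hom R G M M'" and surj: "f ` carrier M = carrier M'"
    and N: "N = {x \<in> carrier M. f x \<in> N'}"
  shows "gsubmodule R G M N"
    and "(`) f \<in> gmodule_iso R G (quotient_gmodule M N) (quotient_gmodule M' N')"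
    and "\<And>x. x \<in> carrier M \<Longrightarrow> f ` (N +>\<^bsub>M\<^esub> x) = N' +>\<^bsub>M'\<^esub> f x"
proof -
  interpret M: gmodule R G M by fact
  interpret M': gmodule R G M' by fact
  interpret N': abelian_subgroup N' M'
    using N' by (rule M'.gsubmodule_abelian_subgroup)
  note fD = gmodule_homD[OF f]
  show sN: "gsubmodule R G M N"
    by (rule M.gsubmoduleI)
      (auto simp: N fD gmodule_hom_zero[OF M M' f] M.gact_closed
        M'.gsubmodule_smult[OF N'] M'.gsubmodule_gact[OF N'])
  show img: "f ` (N +>\<^bsub>M\<^esub> x) = N' +>\<^bsub>M'\<^esub> f x" if x: "x \<in> carrier M" for x
  proof
    show "f ` (N +>\<^bsub>M\<^esub> x) \<subseteq> N' +>\<^bsub>M'\<^esub> f x"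
      using x by (auto simp: a_r_coset_def' N fD)
    show "N' +>\<^bsub>M'\<^esub> f x \<subseteq> f ` (N +>\<^bsub>M\<^esub> x)"
    proof
      fix y assume "y \<in> N' +>\<^bsub>M'\<^esub> f x"
      then obtain h where h: "h \<in> N'" "y = h \<oplus>\<^bsub>M'\<^esub> f x"
        by (auto simp: a_r_coset_def')
      then obtain z where z: "z \<in> carrier M" "h = f z"
        using surj N'.a_Hcarr by (metis imageE)
      then have "y = f (z \<oplus>\<^bsub>M\<^esub> x)" "z \<in> N"
        using h x by (auto simp: fD N)
      then show "y \<in> f ` (N +>\<^bsub>M\<^esub> x)"
        by (auto simp: a_r_coset_def')
    qed
  qed
  note q = M.quotient_carrier[OF sN] M.quotient_add[OF sN] M.quotient_smult[OF sN]
    M.quotient_gact[OF sN]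
  note q' = M'.quotient_carrier[OF N'] M'.quotient_add[OF N'] M'.quotient_smult[OF N']
    M'.quotient_gact[OF N']
  have h: "(`) f \<in> gmodule_hom R G (quotient_gmodule M N) (quotient_gmodule M' N')"
    by (rule gmodule_homI) (auto simp: q q' img fD M.gact_closed simp del: image_eqI intro!: imageI del: equalityI)
  have "inj_on ((`) f) (carrier (quotient_gmodule M N))"
  proof (rule inj_onI)
    fix C D assume "C \<in> carrier (quotient_gmodule M N)" "D \<in> carrier (quotient_gmodule M N)"
      and eq: "f ` C = f ` D"
    then obtain x y where xy: "x \<in> carrier M" "C = N +>\<^bsub>M\<^esub> x" "y \<in> carrier M" "D = N +>\<^bsub>M\<^esub> y"
      by (auto simp: q)
    have "f x \<ominus>\<^bsub>M'\<^esub> f y \<in> N'"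
      using eq xy img fD(1) M'.coset_eq_iff[OF N'] by simp
    \<comment> \<open>Compatibility with differences is recovered from additivity by cancelling
      \<open>f y\<close>.\<close>
    moreover have "f (x \<ominus>\<^bsub>M\<^esub> y) \<oplus>\<^bsub>M'\<^esub> f y = f x"
      using xy by (simp add: fD(2)[symmetric] M.M.minus_eq M.M.a_assoc M.M.l_neg)
    then have "f (x \<ominus>\<^bsub>M\<^esub> y) = f x \<ominus>\<^bsub>M'\<^esub> f y"
      using xy fD(1) by (metis M.M.minus_closed M'.M.minus_eq M'.M.add.inv_solve_right)
    ultimately show "C = D"
      using xy M.coset_eq_iff[OF sN] by (simp add: N)
  qed
  moreover have "(`) f ` carrier (quotient_gmodule M N) = carrier (quotient_gmodule M' N')"
    unfolding q q' surj[symmetric] by (auto simp: img image_iff)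
  ultimately show "(`) f \<in> gmodule_iso R G (quotient_gmodule M N) (quotient_gmodule M' N')"
    using h by (simp add: gmodule_iso_def bij_betw_def)
qed

text \<open>The eigenspace of \<open>a\<close> is stable under the group by equivariance and under
  scalars by commutativity of \<open>R\<close>. It is nonzero, so simplicity makes it
  everything.\<close>

lemma (in simple_gmodule) hom_eq_smult_of_eigenvector:
  assumes f: "f \<in> gmodule_hom R G M M" and a: "a \<in> carrier R"
    and x: "x \<in> carrier M" "x \<noteq> \<zero>\<^bsub>M\<^esub>" "f x = a \<odot>\<^bsub>M\<^esub> x"
    and y: "y \<in> carrier M"
  shows "f y = a \<odot>\<^bsub>M\<^esub> y"
proof -
  note fD = gmodule_homD[OF f]
  define S where "S = {x \<in> carrier M. f x = a \<odot>\<^bsub>M\<^esub> x}"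
  have "gsubmodule R G M S"
  proof (rule gsubmoduleI)
    show "b \<odot>\<^bsub>M\<^esub> x \<in> S" if "b \<in> carrier R" "x \<in> S" for b x
      using that a by (simp add: S_def fD smult_assoc1[symmetric] R.m_comm)
  qed (use a gmodule_hom_zero[OF gmodule gmodule f] in
      \<open>auto simp: S_def fD smult_r_distr gact_closed gact_smult\<close>)
  then have "S = {\<zero>\<^bsub>M\<^esub>} \<or> S = carrier M" by (rule only_trivial)
  moreover have "x \<in> S" using x by (simp add: S_def)
  ultimately have "y \<in> S" using x y by auto
  then show ?thesis by (simp add: S_def)
qed

text \<open>Conjugating \<open>h\<close> with \<open>f\<close> gives an endomorphism of
  \<open>N\<close>; its scalar is carried back by the linearity and injectivity of
  \<open>f\<close>.\<close>

lemma gmodule_hom_scalar_iso: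
  assumes M: "gmodule R G M" and f: "f \<in> gmodule_iso R G M N"
    and N: "\<And>h. h \<in> gmodule_hom R G N N \<Longrightarrow> \<exists>a\<in>carrier R. \<forall>x\<in>carrier N. h x = a \<odot>\<^bsub>N\<^esub> x"
    and h: "h \<in> gmodule_hom R G M M"
  shows "\<exists>a\<in>carrier R. \<forall>x\<in>carrier M. h x = a \<odot>\<^bsub>M\<^esub> x"
proof -
  interpret M: gmodule R G M by fact
  let ?i = "inv_into (carrier M) f"
  from f have fh: "f \<in> gmodule_hom R G M N" and b: "bij_betw f (carrier M) (carrier N)"
    by (auto simp: gmodule_iso_def)
  have i: "?i \<in> gmodule_hom R G N M"
    using gmodule_iso_inv[OF M f] by (simp add: gmodule_iso_def)
  have "f \<circ> (h \<circ> ?i) \<in> gmodule_hom R G N N"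
    by (intro gmodule_hom_comp[OF _ fh] gmodule_hom_comp[OF i h])
  then obtain a where a: "a \<in> carrier R" "\<And>x. x \<in> carrier N \<Longrightarrow> f (h (?i x)) = a \<odot>\<^bsub>N\<^esub> x"
    using N by (metis comp_apply)
  have "h x = a \<odot>\<^bsub>M\<^esub> x" if x: "x \<in> carrier M" for x
  proof -
    have "?i (f x) = x" using b x by (simp add: bij_betw_def)
    then have "f (h x) = a \<odot>\<^bsub>N\<^esub> f x"
      using a(2)[of "f x"] gmodule_homD(1)[OF fh x] by simp
    also have "\<dots> = f (a \<odot>\<^bsub>M\<^esub> x)"
      using gmodule_homD(3)[OF fh] a x by simp
    finally show ?thesis
      using b x a gmodule_homD(1)[OF h] by (auto simp: bij_betw_def inj_on_def)
  qed
  with a show ?thesis by blast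
qed

lemma gmodule_End_isomorphic_base:
  assumes R: "field R" and M: "gmodule R G M" and nz: "carrier M \<noteq> {\<zero>\<^bsub>M\<^esub>}"
    and scalar: "\<And>h. h \<in> gmodule_hom R G M M \<Longrightarrow>
      \<exists>a\<in>carrier R. \<forall>x\<in>carrier M. h x = a \<odot>\<^bsub>M\<^esub> x"
  shows "algebra_isomorphic R (gmodule_End R G M) (ring_as_algebra R)"
proof -
  interpret R: field R by fact
  interpret M: gmodule R G M by fact
  obtain v where v: "v \<in> carrier M" "v \<noteq> \<zero>\<^bsub>M\<^esub>"
    using nz M.M.zero_closed by blast
  \<comment> \<open>Distinct scalars differ by a unit of the field, which cannot kill the nonzero
    vector \<open>v\<close>. This is the injectivity of the map from scalars to
    endomorphisms.\<close>
  have unique: "a = b"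
    if ab: "a \<in> carrier R" "b \<in> carrier R" and eq: "a \<odot>\<^bsub>M\<^esub> v = b \<odot>\<^bsub>M\<^esub> v" for a b
  proof (rule ccontr)
    assume "a \<noteq> b"
    then have "a \<ominus>\<^bsub>R\<^esub> b \<noteq> \<zero>\<^bsub>R\<^esub>" using ab by simp
    then have u: "a \<ominus>\<^bsub>R\<^esub> b \<in> Units R" using ab R.field_Units by auto
    have "(a \<ominus>\<^bsub>R\<^esub> b) \<odot>\<^bsub>M\<^esub> v = a \<odot>\<^bsub>M\<^esub> v \<oplus>\<^bsub>M\<^esub> \<ominus>\<^bsub>M\<^esub> (b \<odot>\<^bsub>M\<^esub> v)"
      using ab v by (simp add: R.minus_eq M.smult_l_distr M.smult_l_minus)
    then have "(a \<ominus>\<^bsub>R\<^esub> b) \<odot>\<^bsub>M\<^esub> v = \<zero>\<^bsub>M\<^esub>"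
      using eq ab v by (simp add: M.M.r_neg)
    then have "(inv\<^bsub>R\<^esub> (a \<ominus>\<^bsub>R\<^esub> b) \<otimes>\<^bsub>R\<^esub> (a \<ominus>\<^bsub>R\<^esub> b)) \<odot>\<^bsub>M\<^esub> v = \<zero>\<^bsub>M\<^esub>"
      using M.smult_assoc1[OF R.Units_inv_closed[OF u] R.Units_closed[OF u] v(1)]
        R.Units_inv_closed[OF u] by simp
    with R.Units_l_inv[OF u] v show False by simp
  qed
  let ?E = "gmodule_End R G M"
  \<comment> \<open>The restriction to the carrier makes \<open>s a\<close> extensional, as
    membership in \<open>gmodule_End\<close> requires.\<close>
  define s where "s = (\<lambda>a. \<lambda>x\<in>carrier M. a \<odot>\<^bsub>M\<^esub> x)"
  have sE: "s a \<in> carrier ?E" if "a \<in> carrier R" for a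
    using that unfolding gmodule_End_def s_def
    by (auto intro!: gmodule_homI simp: M.smult_r_distr M.smult_assoc1[symmetric] R.m_comm
        M.gact_closed M.gact_smult)
  have Es: "\<exists>a\<in>carrier R. f = s a" if "f \<in> carrier ?E" for f
  proof -
    have "f \<in> gmodule_hom R G M M" "f \<in> extensional (carrier M)"
      using that by (auto simp: gmodule_End_def)
    with scalar[of f] show ?thesis
      unfolding s_def by (metis restrict_ext extensional_restrict)
  qed
  have inj: "inj_on s (carrier R)"
  proof (rule inj_onI)
    fix a b assume ab: "a \<in> carrier R" "b \<in> carrier R" "s a = s b"
    from fun_cong[OF ab(3), of v] have "a \<odot>\<^bsub>M\<^esub> v = b \<odot>\<^bsub>M\<^esub> v"
      using v by (simp add: s_def)
    with ab show "a = b" using unique by blast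
  qed
  have bij: "bij_betw s (carrier R) (carrier ?E)"
    using inj sE Es by (auto simp: bij_betw_def image_iff)
  \<comment> \<open>The natural map \<open>s\<close> runs from scalars to endomorphisms; the
    isomorphism asked for runs the other way.\<close>
  define h where "h = inv_into (carrier R) s"
  have hs: "h (s a) = a" if "a \<in> carrier R" for a
    using inj that by (simp add: h_def)
  have smul: "s a \<otimes>\<^bsub>?E\<^esub> s b = s (a \<otimes>\<^bsub>R\<^esub> b)" if "a \<in> carrier R" "b \<in> carrier R" for a b
    using that by (auto simp: gmodule_End_def s_def compose_def M.smult_assoc1 restrict_def)
  have sadd: "s a \<oplus>\<^bsub>?E\<^esub> s b = s (a \<oplus>\<^bsub>R\<^esub> b)" if "a \<in> carrier R" "b \<in> carrier R" for a b
    using that by (auto simp: gmodule_End_def s_def M.smult_l_distr restrict_def)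
  have ssm: "a \<odot>\<^bsub>?E\<^esub> s b = s (a \<otimes>\<^bsub>R\<^esub> b)" if "a \<in> carrier R" "b \<in> carrier R" for a b
    using that by (auto simp: gmodule_End_def s_def M.smult_assoc1 restrict_def)
  have s1: "\<one>\<^bsub>?E\<^esub> = s \<one>\<^bsub>R\<^esub>"
    by (auto simp: gmodule_End_def s_def restrict_def)
  have "h \<in> ring_iso ?E (ring_as_algebra R)"
  proof -
    have "h \<in> ring_hom ?E (ring_as_algebra R)"
    proof (rule ring_hom_memI)
      fix f g assume "f \<in> carrier ?E" "g \<in> carrier ?E"
      then obtain a b where "a \<in> carrier R" "f = s a" "b \<in> carrier R" "g = s b"
        using Es by blast
      then show "h (f \<otimes>\<^bsub>?E\<^esub> g) = h f \<otimes>\<^bsub>ring_as_algebra R\<^esub> h g"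
        and "h (f \<oplus>\<^bsub>?E\<^esub> g) = h f \<oplus>\<^bsub>ring_as_algebra R\<^esub> h g"
        and "h f \<in> carrier (ring_as_algebra R)"
        by (auto simp: smul sadd hs ring_as_algebra_def)
    qed (auto simp: s1 hs ring_as_algebra_def)
    moreover have "bij_betw h (carrier ?E) (carrier (ring_as_algebra R))"
      using bij_betw_inv_into[OF bij] by (simp add: h_def ring_as_algebra_def)
    ultimately show ?thesis by (simp add: ring_iso_def)
  qed
  moreover have "h (a \<odot>\<^bsub>?E\<^esub> f) = a \<odot>\<^bsub>ring_as_algebra R\<^esub> h f"
    if "a \<in> carrier R" "f \<in> carrier ?E" for a f
    using Es[OF that(2)] that(1) by (auto simp: ssm hs ring_as_algebra_def)
  ultimately show ?thesis
    unfolding algebra_isomorphic_def by blast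
qed

section \<open>Polynomials and derivations\<close>

lemma mpoly_sum_single:
  fixes p :: "'a \<Rightarrow>\<^sub>0 'b::comm_monoid_add"
  shows "p = (\<Sum>m\<in>Poly_Mapping.keys p. Poly_Mapping.single m (Poly_Mapping.lookup p m))"
proof (rule poly_mapping_eqI)
  fix k
  show "Poly_Mapping.lookup p k = Poly_Mapping.lookup
      (\<Sum>m\<in>Poly_Mapping.keys p. Poly_Mapping.single m (Poly_Mapping.lookup p m)) k"
    by (auto simp: lookup_sum lookup_single when_def sum.delta in_keys_iff)
qed

lemma mpoly_add_induct [case_names zero single add]:
  fixes p :: "'a \<Rightarrow>\<^sub>0 'b::comm_monoid_add"
  assumes "P 0" and "\<And>m c. P (Poly_Mapping.single m c)"
    and "\<And>p q. P p \<Longrightarrow> P q \<Longrightarrow> P (p + q)"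
  shows "P p"
proof -
  have "P (\<Sum>m\<in>A. Poly_Mapping.single m (Poly_Mapping.lookup p m))" if "finite A" for A
    using that by (induction A rule: finite_induct) (auto intro: assms)
  then show ?thesis
    using mpoly_sum_single[of p] by (metis finite_keys)
qed

lemma Const_0 [simp]: "Const 0 = 0"
  and Const_1 [simp]: "Const 1 = 1"
  and Const_add: "Const (a + b) = Const a + Const b"
  and Const_mult: "Const (a * b) = Const a * Const b"
  and Const_minus: "Const (- a) = - Const a"
  and Const_diff: "Const (a - b) = Const a - Const b"
  by (simp_all add: Const_def single_add mult_single single_uminus single_diff)

lemma Const_power: "Const (a ^ k) = Const a ^ k"
  by (induction k) (simp_all add: Const_mult)

lemma Const_eq_iff [simp]: "Const a = Const b \<longleftrightarrow> a = b"
  unfolding Const_def by (metis lookup_single_eq)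

lemma Const_eq_0_iff [simp]: "Const a = 0 \<longleftrightarrow> a = 0"
  by (metis Const_0 Const_eq_iff)

lemma Const_mult_cancel: "a \<noteq> 0 \<Longrightarrow> Const (inverse a) * (Const a * p) = p"
  by (simp add: mult.assoc[symmetric] Const_mult[symmetric])

lemma Const_mult_single: "Const c * Poly_Mapping.single m d = Poly_Mapping.single m (c * d)"
  by (simp add: Const_def mult_single)

lemma Var_power: "Var i ^ k = Poly_Mapping.single (Poly_Mapping.single i k) 1"
  by (induction k) (simp_all add: Var_def mult_single single_add[symmetric] add.commute)

lemma exponent_sum_single:
  fixes m :: "'n::finite \<Rightarrow>\<^sub>0 nat"
  shows "m = (\<Sum>i\<in>UNIV. Poly_Mapping.single i (Poly_Mapping.lookup m i))"
  by (rule poly_mapping_eqI) (simp add: lookup_sum lookup_single when_def)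

lemma prod_single:
  "(\<Prod>i\<in>A. Poly_Mapping.single (f i) 1) = Poly_Mapping.single (\<Sum>i\<in>A. f i) (1 :: 'k::comm_semiring_1)"
  by (induction A rule: infinite_finite_induct) (simp_all add: mult_single)

lemma single_eq_prod_Var:
  fixes m :: "'n::finite \<Rightarrow>\<^sub>0 nat"
  shows "Poly_Mapping.single m c = Const c * (\<Prod>i\<in>UNIV. Var i ^ Poly_Mapping.lookup m i)"
  by (simp add: Var_power prod_single exponent_sum_single[symmetric] Const_mult_single)

text \<open>Constants and variables generate the polynomial ring. Hence derivations and
  automorphisms can be compared on variables alone.\<close>

lemma mpoly_induct [case_names Const Var add mult]:
  fixes p :: "('n::finite, 'k::field) mpoly"
  assumes c: "\<And>c. P (Const c)" and v: "\<And>i. P (Var i)"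
    and a: "\<And>p q. P p \<Longrightarrow> P q \<Longrightarrow> P (p + q)" and m: "\<And>p q. P p \<Longrightarrow> P q \<Longrightarrow> P (p * q)"
  shows "P p"
proof -
  have 1: "P 1" using c[of 1] by simp
  have pow: "P (Var i ^ k)" for i k
    by (induction k) (auto intro: 1 m v)
  have "P (\<Prod>i\<in>A. Var i ^ f i)" for A :: "'n set" and f
    by (induction A rule: infinite_finite_induct) (auto intro: 1 m pow)
  then have "P (Poly_Mapping.single e c)" for e c
    using single_eq_prod_Var[of e c] m c by metis
  moreover have "P 0" using c[of 0] by simp
  ultimately show ?thesis
    using a by (induction p rule: mpoly_add_induct) auto
qed

text \<open>A coefficientwise description without truncated subtraction and without a sum over
  \<open>keys\<close>, from which additivity and the commutation of partial derivatives are
  immediate.\<close>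

lemma lookup_pderiv:
  "Poly_Mapping.lookup (pderiv i p) m =
    of_nat (Suc (Poly_Mapping.lookup m i)) * Poly_Mapping.lookup p (m + Poly_Mapping.single i 1)"
proof -
  let ?e = "Poly_Mapping.single i (1::nat)"
  have "Poly_Mapping.lookup (pderiv i p) m = (\<Sum>m'\<in>Poly_Mapping.keys p.
      of_nat (Poly_Mapping.lookup m' i) * Poly_Mapping.lookup p m' when m' - ?e = m)"
    by (simp add: pderiv_def lookup_sum lookup_single)
  also have "\<dots> = (\<Sum>m'\<in>Poly_Mapping.keys p. if m' = m + ?e then
      of_nat (Suc (Poly_Mapping.lookup m i)) * Poly_Mapping.lookup p m' else 0)"
  proof (rule sum.cong[OF refl])
    fix m'
    show "(of_nat (Poly_Mapping.lookup m' i) * Poly_Mapping.lookup p m' when m' - ?e = m) =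
        (if m' = m + ?e then of_nat (Suc (Poly_Mapping.lookup m i)) * Poly_Mapping.lookup p m' else 0)"
    \<comment> \<open>If the variable does not occur in \<open>m'\<close>, the truncated difference
      may still equal \<open>m\<close>, but the factor \<open>of_nat 0\<close> removes the
      term.\<close>
    proof (cases "Poly_Mapping.lookup m' i = 0")
      case True
      then have "m' \<noteq> m + ?e" by (auto simp: lookup_add)
      then show ?thesis using True by (simp add: when_def)
    next
      case False
      then have "m' - ?e + ?e = m'"
        by (intro poly_mapping_eqI) (auto simp: lookup_add lookup_minus lookup_single when_def)
      then have "m' - ?e = m \<longleftrightarrow> m' = m + ?e" by (metis add_diff_cancel_right')
      then show ?thesis by (auto simp: lookup_add)
    qed
  qed
  also have "\<dots> = of_nat (Suc (Poly_Mapping.lookup m i)) * Poly_Mapping.lookup p (m + ?e)"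
    by (simp add: sum.delta in_keys_iff)
  finally show ?thesis .
qed

lemma pderiv_add: "pderiv i (p + q) = pderiv i p + pderiv i q"
  by (rule poly_mapping_eqI) (simp add: lookup_pderiv lookup_add ring_distribs)

lemma pderiv_zero [simp]: "pderiv i 0 = 0"
  by (simp add: pderiv_def)

lemma pderiv_single:
  "pderiv i (Poly_Mapping.single m c) =
    Poly_Mapping.single (m - Poly_Mapping.single i 1) (of_nat (Poly_Mapping.lookup m i) * c)"
  by (simp add: pderiv_def)

lemma pderiv_single_mult:
  "pderiv i (Poly_Mapping.single m c * Poly_Mapping.single m' d) =
    pderiv i (Poly_Mapping.single m c) * Poly_Mapping.single m' d
    + Poly_Mapping.single m c * pderiv i (Poly_Mapping.single m' d)"
proof -
  let ?e = "Poly_Mapping.single i (1::nat)"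
  have shift: "m + m' - ?e = m - ?e + m'" if "Poly_Mapping.lookup m i \<noteq> 0" for m m'
    using that by (intro poly_mapping_eqI) (auto simp: lookup_add lookup_minus lookup_single when_def)
  show ?thesis
    using shift[of m m'] shift[of m' m]
    by (cases "Poly_Mapping.lookup m i = 0"; cases "Poly_Mapping.lookup m' i = 0")
      (simp_all add: pderiv_single mult_single lookup_add single_add[symmetric] add.commute
        ring_distribs mult_ac)
qed

lemma pderiv_mult: "pderiv i (p * q) = pderiv i p * q + p * pderiv i q"
proof (induction p rule: mpoly_add_induct)
  case (single m c)
  show ?case
  proof (induction q rule: mpoly_add_induct)
    case (single m' d)
    show ?case by (rule pderiv_single_mult)
  qed (simp_all add: pderiv_add ring_distribs)
qed (simp_all add: pderiv_add ring_distribs)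

lemma pderiv_Const [simp]: "pderiv i (Const c) = 0"
  by (simp add: Const_def pderiv_single)

section \<open>Derivations and their divergence\<close>

lemma pderiv_mem_poly_Der: "pderiv i \<in> poly_Der"
  by (simp add: poly_Der_def pderiv_add pderiv_mult)

lemma poly_DerD:
  assumes "\<delta> \<in> poly_Der"
  shows "\<delta> (p + q) = \<delta> p + \<delta> q" and "\<delta> (Const c * p) = Const c * \<delta> p"
    and "\<delta> (p * q) = \<delta> p * q + p * \<delta> q"
  using assms by (auto simp: poly_Der_def)

lemma poly_Der_zero:
  assumes "\<delta> \<in> poly_Der" shows "\<delta> 0 = 0"
  using poly_DerD(1)[OF assms, of 0 0] by simp

lemma poly_Der_Const:
  assumes "\<delta> \<in> poly_Der" shows "\<delta> (Const c) = 0"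
proof -
  have "\<delta> 1 = 0" using poly_DerD(3)[OF assms, of 1 1] by simp
  then show ?thesis using poly_DerD(2)[OF assms, of c 1] by simp
qed

lemma poly_Der_sum:
  assumes "\<delta> \<in> poly_Der" shows "\<delta> (sum f A) = (\<Sum>x\<in>A. \<delta> (f x))"
  by (induction A rule: infinite_finite_induct) (simp_all add: poly_Der_zero[OF assms] poly_DerD(1)[OF assms])

lemma poly_Der_eqI:
  fixes \<delta> \<epsilon> :: "('n::finite, 'k::field) mpoly_map"
  assumes "\<delta> \<in> poly_Der" "\<epsilon> \<in> poly_Der" "\<And>i. \<delta> (Var i) = \<epsilon> (Var i)"
  shows "\<delta> p = \<epsilon> p"
  by (induction p rule: mpoly_induct)
    (simp_all add: assms(3) poly_Der_Const[OF assms(1)] poly_Der_Const[OF assms(2)]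
      poly_DerD[OF assms(1)] poly_DerD[OF assms(2)])

lemma sum_pderiv_mem_poly_Der: "(\<lambda>p. \<Sum>i\<in>UNIV. a i * pderiv i p) \<in> poly_Der"
  by (simp add: poly_Der_def pderiv_add pderiv_mult sum.distrib sum_distrib_left sum_distrib_right
      ring_distribs mult_ac)

lemma sum_pderiv_Var: "(\<Sum>i\<in>UNIV. a i * pderiv i (Var j)) = (a j :: ('n::finite, 'k::field) mpoly)"
proof -
  have "(\<Sum>i\<in>UNIV. a i * pderiv i (Var j)) = (\<Sum>i\<in>UNIV. if i = j then a i else 0)"
    by (rule sum.cong) (auto simp: pderiv_Var)
  then show ?thesis by simp
qed

lemma poly_Der_eq_sum_pderiv:
  fixes \<delta> :: "('n::finite, 'k::field) mpoly_map"
  assumes "\<delta> \<in> poly_Der"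
  shows "\<delta> p = (\<Sum>i\<in>UNIV. \<delta> (Var i) * pderiv i p)"
  by (rule poly_Der_eqI[OF assms sum_pderiv_mem_poly_Der]) (simp add: sum_pderiv_Var)

text \<open>Eliminates the definite description in \<open>Der_coeffs\<close>: the coefficients of a
  derivation are its values on the variables.\<close>

lemma divergence_eq:
  fixes \<delta> :: "('n::finite, 'k::field) mpoly_map"
  assumes "\<delta> \<in> poly_Der"
  shows "divergence \<delta> = (\<Sum>i\<in>UNIV. pderiv i (\<delta> (Var i)))"
proof -
  have "\<delta> = (\<lambda>p. \<Sum>i\<in>UNIV. \<delta> (Var i) * pderiv i p)"
    by (rule ext) (rule poly_Der_eq_sum_pderiv[OF assms])
  then have "Der_coeffs \<delta> = (\<lambda>i. \<delta> (Var i))"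
    using Der_coeffs_unique[of "\<lambda>i. \<delta> (Var i)"] by simp
  then show ?thesis by (simp add: divergence_def)
qed

text \<open>If \<open>x_i\<close> occurs in a monomial, its coefficient reappears in the derivative
  along \<open>x_i\<close>, multiplied by an exponent that is nonzero in characteristic
  zero.\<close>

lemma pderiv_eq_0_imp_Const:
  fixes p :: "('n, 'k::field_char_0) mpoly"
  assumes "\<And>i. pderiv i p = 0"
  shows "p = Const (Poly_Mapping.lookup p 0)"
proof (rule poly_mapping_eqI)
  fix m
  show "Poly_Mapping.lookup p m = Poly_Mapping.lookup (Const (Poly_Mapping.lookup p 0)) m"
  proof (cases "m = 0")
    case False
    then obtain i where i: "Poly_Mapping.lookup m i \<noteq> 0"
      by (metis lookup_zero poly_mapping_eqI)
    let ?e = "Poly_Mapping.single i (1::nat)"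
    have "m - ?e + ?e = m"
      using i by (intro poly_mapping_eqI) (auto simp: lookup_add lookup_minus lookup_single when_def)
    moreover have "Poly_Mapping.lookup (pderiv i p) (m - ?e) = 0" using assms by simp
    ultimately have "Poly_Mapping.lookup p m = 0"
      by (simp add: lookup_pderiv del: of_nat_Suc)
    then show ?thesis using False by (simp add: Const_def lookup_single)
  qed (simp add: Const_def)
qed

text \<open>Antiderivatives are taken term by term, dividing by the raised exponent.\<close>

lemma pderiv_surj:
  fixes q :: "('n, 'k::field_char_0) mpoly"
  shows "\<exists>p. pderiv i p = q"
proof (induction q rule: mpoly_add_induct)
  case zero show ?case by (rule exI[of _ 0]) simp
next
  case (single m c)
  have "pderiv i (Poly_Mapping.single (m + Poly_Mapping.single i 1)
      (c / of_nat (Suc (Poly_Mapping.lookup m i)))) = Poly_Mapping.single m c"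
    by (simp add: pderiv_single lookup_add del: of_nat_Suc)
  then show ?case by blast
next
  case (add p q) then show ?case by (metis pderiv_add)
qed


section \<open>Substitution and units\<close>

text \<open>Coefficients pass through a separate map \<open>h\<close>, so that one construction
  covers both endomorphisms of the polynomial ring (\<open>h = Const\<close>) and substitution into
  a univariate polynomial ring.\<close>

definition insertion :: "('k::field \<Rightarrow> 'a::comm_ring_1) \<Rightarrow> ('n::finite \<Rightarrow> 'a) \<Rightarrow> ('n, 'k) mpoly \<Rightarrow> 'a"
  where "insertion h f p = (\<Sum>m\<in>Poly_Mapping.keys p.
    h (Poly_Mapping.lookup p m) * (\<Prod>i\<in>UNIV. f i ^ Poly_Mapping.lookup m i))"

context
  fixes h :: "'k::field \<Rightarrow> 'a::comm_ring_1" and f :: "'n::finite \<Rightarrow> 'a"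
  assumes h0: "h 0 = 0" and h1: "h 1 = 1"
    and hadd: "\<And>a b. h (a + b) = h a + h b" and hmult: "\<And>a b. h (a * b) = h a * h b"
begin

lemma insertion_add: "insertion h f (p + q) = insertion h f p + insertion h f q"
  unfolding insertion_def
  by (rule setsum_keys_plus_distrib) (simp_all add: h0 hadd ring_distribs)

lemma insertion_zero: "insertion h f 0 = 0"
  by (simp add: insertion_def)

lemma insertion_single:
  "insertion h f (Poly_Mapping.single m c) = h c * (\<Prod>i\<in>UNIV. f i ^ Poly_Mapping.lookup m i)"
  by (simp add: insertion_def h0)

lemma insertion_mult: "insertion h f (p * q) = insertion h f p * insertion h f q"
proof (induction p rule: mpoly_add_induct)
  case (single m c)
  show ?case
  proof (induction q rule: mpoly_add_induct)
    case (single m' d)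
    show ?case
      by (simp add: mult_single insertion_single hmult lookup_add power_add prod.distrib mult_ac)
  qed (simp_all add: insertion_zero insertion_add ring_distribs)
qed (simp_all add: insertion_zero insertion_add ring_distribs)

lemma insertion_Const: "insertion h f (Const c) = h c"
  by (simp add: Const_def insertion_single)

lemma insertion_one: "insertion h f 1 = 1"
  using insertion_Const[of 1] by (simp add: h1)

lemma insertion_Var: "insertion h f (Var i) = f i"
proof -
  have "(\<Prod>j\<in>UNIV. f j ^ Poly_Mapping.lookup (Poly_Mapping.single i 1) j) =
      (\<Prod>j\<in>UNIV. if i = j then f j else 1)"
    by (rule prod.cong) (auto simp: lookup_single)
  then show ?thesis
    by (simp add: Var_def insertion_single h1)
qed

end

section \<open>Units of the polynomial ring\<close>

lemma digits_unique:
  fixes a b :: "nat \<Rightarrow> nat"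
  assumes "\<And>j. j < n \<Longrightarrow> a j < N" "\<And>j. j < n \<Longrightarrow> b j < N"
    and "(\<Sum>j<n. a j * N ^ j) = (\<Sum>j<n. b j * N ^ j)" and "j < n"
  shows "a j = b j"
  using assms
proof (induction n arbitrary: a b j)
  case (Suc n)
  have split: "(\<Sum>j<Suc n. c j * N ^ j) = c 0 + N * (\<Sum>j<n. c (Suc j) * N ^ j)" for c :: "nat \<Rightarrow> nat"
    by (simp only: sum.lessThan_Suc_shift) (simp add: sum_distrib_left mult_ac)
  have lt: "a 0 < N" "b 0 < N" using Suc.prems by auto
  have eq: "a 0 + N * (\<Sum>j<n. a (Suc j) * N ^ j) = b 0 + N * (\<Sum>j<n. b (Suc j) * N ^ j)"
    using Suc.prems(3) unfolding split .
  \<comment> \<open>The residue modulo \<open>N\<close> is the lowest digit; cancelling it and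
    dividing by \<open>N\<close> leads to the induction hypothesis.\<close>
  have 0: "a 0 = b 0"
    using arg_cong[OF eq, of "\<lambda>x. x mod N"] lt by simp
  have "(\<Sum>j<n. a (Suc j) * N ^ j) = (\<Sum>j<n. b (Suc j) * N ^ j)"
    using eq 0 lt by simp
  then have "a (Suc j) = b (Suc j)" if "j < n" for j
    using Suc.IH[of "\<lambda>j. a (Suc j)" "\<lambda>j. b (Suc j)" j] Suc.prems that by simp
  with 0 Suc.prems(4) show ?case by (cases j) auto
qed simp

text \<open>Kronecker substitution: for large \<open>N\<close> sending the variables to distinct powers
  \<open>t ^ N ^ j\<close> separates the monomials of \<open>u\<close>, and units of \<open>K[t]\<close> are constant.\<close>

lemma mpoly_unit_imp_Const:
  fixes u v :: "('n::finite, 'k::field) mpoly"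
  assumes uv: "u * v = 1"
  shows "u \<in> range Const"
proof -
  obtain e :: "'n \<Rightarrow> nat" where e: "bij_betw e UNIV {..<CARD('n)}"
    using ex_bij_betw_finite_nat[of "UNIV :: 'n set"] by (auto simp: atLeast0LessThan)
  have "finite (\<Union>m\<in>Poly_Mapping.keys u. Poly_Mapping.lookup m ` UNIV)" by simp
  then obtain N where N: "\<And>m i. m \<in> Poly_Mapping.keys u \<Longrightarrow> Poly_Mapping.lookup m i < N"
    unfolding finite_nat_set_iff_bounded by auto
  \<comment> \<open>The successor keeps the base positive, so that a weight \<open>w m\<close> equal
    to zero forces every exponent of \<open>m\<close> to vanish.\<close>
  define M where "M = Suc N"
  define w where "w m = (\<Sum>i\<in>UNIV. Poly_Mapping.lookup m i * M ^ e i)" for m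
  define c where "c = (\<lambda>a::'k. [:a:])"
  define \<phi> where "\<phi> = insertion c (\<lambda>i. monom 1 (M ^ e i))"
  have c: "c 0 = 0" "c 1 = 1" "\<And>a b. c (a + b) = c a + c b" "\<And>a b. c (a * b) = c a * c b"
    by (simp_all add: c_def one_pCons)
  have "(\<Prod>i\<in>A. monom 1 (f i) ^ g i) = monom (1::'k) (\<Sum>i\<in>A. g i * f i)"
    for A :: "'n set" and f g :: "'n \<Rightarrow> nat"
    by (induction A rule: infinite_finite_induct) (simp_all add: monom_power mult_monom mult.commute)
  then have \<phi>: "\<phi> p = (\<Sum>m\<in>Poly_Mapping.keys p. monom (Poly_Mapping.lookup p m) (w m))" for p
    by (simp add: \<phi>_def insertion_def w_def c_def smult_monom)
  have "\<phi> u * \<phi> v = \<phi> (u * v)"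
    unfolding \<phi>_def by (rule insertion_mult[OF c, symmetric])
  also have "\<dots> = 1"
    unfolding uv \<phi>_def by (rule insertion_one[OF c])
  finally have "\<phi> u * \<phi> v = 1" .
  then have deg: "Polynomial.degree (\<phi> u) = 0"
    by (metis add_is_0 degree_1 degree_mult_eq mult_zero_left mult_zero_right zero_neq_one)
  have inj: "m = m'" if m: "m \<in> Poly_Mapping.keys u" "m' \<in> Poly_Mapping.keys u" and eq: "w m = w m'" for m m'
  proof -
    have w_alt: "w m = (\<Sum>j<CARD('n). Poly_Mapping.lookup m (inv_into UNIV e j) * M ^ j)" for m
      unfolding w_def
      by (rule sum.reindex_bij_witness[of _ "inv_into UNIV e" e])
        (use e in \<open>auto simp: bij_betw_def f_inv_into_f\<close>)
    show ?thesis
    proof (rule poly_mapping_eqI)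
      fix i
      have "e i < CARD('n)" "inv_into UNIV e (e i) = i" using e by (auto simp: bij_betw_def)
      moreover have "Poly_Mapping.lookup m (inv_into UNIV e (e i)) = Poly_Mapping.lookup m' (inv_into UNIV e (e i))"
        by (rule digits_unique[where n = "CARD('n)" and N = M])
          (use m N eq[unfolded w_alt] \<open>e i < CARD('n)\<close> in \<open>auto simp: M_def less_SucI\<close>)
      ultimately show "Poly_Mapping.lookup m i = Poly_Mapping.lookup m' i" by simp
    qed
  qed
  have "m = 0" if m: "m \<in> Poly_Mapping.keys u" for m
  proof -
    \<comment> \<open>Distinct monomials of \<open>u\<close> have distinct weights, so nothing
      cancels and \<open>w m\<close> really occurs as an exponent in \<open>\<phi> u\<close>, whose
      degree is zero.\<close>
    have "coeff (\<phi> u) (w m) = (\<Sum>m'\<in>Poly_Mapping.keys u. if w m' = w m then Poly_Mapping.lookup u m' else 0)"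
      by (simp add: \<phi> coeff_sum coeff_monom)
    also have "\<dots> = (\<Sum>m'\<in>Poly_Mapping.keys u. if m' = m then Poly_Mapping.lookup u m' else 0)"
      using inj[OF _ m] by (intro sum.cong) auto
    also have "\<dots> = Poly_Mapping.lookup u m" using m by (simp add: sum.delta)
    finally have "coeff (\<phi> u) (w m) \<noteq> 0" using m by (simp add: in_keys_iff)
    then have "w m = 0" using deg le_degree by fastforce
    then have "Poly_Mapping.lookup m i = 0" for i by (simp add: w_def M_def)
    then show "m = 0" by (intro poly_mapping_eqI) simp
  qed
  then have "u = Const (Poly_Mapping.lookup u 0)"
    unfolding Const_def by (intro poly_mapping_eqI) (metis in_keys_iff lookup_single_eq lookup_single_not_eq)
  then show ?thesis by blast
qed

section \<open>Shears\<close>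

lemma poly_AutD:
  assumes "\<sigma> \<in> carrier poly_Aut"
  shows "bij \<sigma>" and "\<sigma> (p + q) = \<sigma> p + \<sigma> q" and "\<sigma> (p * q) = \<sigma> p * \<sigma> q" and "\<sigma> (Const c) = Const c"
  using assms by (auto simp: poly_Aut_def)

lemma poly_Aut_zero: "\<sigma> \<in> carrier poly_Aut \<Longrightarrow> \<sigma> 0 = 0"
  and poly_Aut_one: "\<sigma> \<in> carrier poly_Aut \<Longrightarrow> \<sigma> 1 = 1"
  using poly_AutD(4)[of \<sigma> 0] poly_AutD(4)[of \<sigma> 1] by simp_all

lemma poly_Aut_sum:
  assumes "\<sigma> \<in> carrier poly_Aut" shows "\<sigma> (sum f A) = (\<Sum>x\<in>A. \<sigma> (f x))"
  by (induction A rule: infinite_finite_induct) (simp_all add: poly_Aut_zero[OF assms] poly_AutD(2)[OF assms])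

lemma poly_Aut_inv_into:
  assumes "\<sigma> \<in> carrier poly_Aut"
  shows "inv_into UNIV \<sigma> (\<sigma> p) = p" and "\<sigma> (inv_into UNIV \<sigma> p) = p"
    and "inv_into UNIV \<sigma> \<in> carrier poly_Aut"
proof -
  note D = poly_AutD[OF assms]
  show 1: "inv_into UNIV \<sigma> (\<sigma> p) = p" for p using D(1) by (simp add: bij_def)
  show 2: "\<sigma> (inv_into UNIV \<sigma> p) = p" for p using D(1) by (simp add: bij_def surj_f_inv_f)
  have "inv_into UNIV \<sigma> (p + q) = inv_into UNIV \<sigma> p + inv_into UNIV \<sigma> q" for p q
    by (metis 1 2 D(2))
  moreover have "inv_into UNIV \<sigma> (p * q) = inv_into UNIV \<sigma> p * inv_into UNIV \<sigma> q" for p q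
    by (metis 1 2 D(3))
  moreover have "inv_into UNIV \<sigma> (Const c) = Const c" for c
    by (metis 1 D(4))
  ultimately show "inv_into UNIV \<sigma> \<in> carrier poly_Aut"
    using D(1) by (simp add: poly_Aut_def bij_imp_bij_inv)
qed

lemma group_poly_Aut: "group poly_Aut"
proof (rule groupI)
  fix \<sigma> :: "('n, 'k::field) mpoly_map" assume s: "\<sigma> \<in> carrier poly_Aut"
  have "inv_into UNIV \<sigma> \<otimes>\<^bsub>poly_Aut\<^esub> \<sigma> = \<one>\<^bsub>poly_Aut\<^esub>"
    using poly_Aut_inv_into(1)[OF s] by (auto simp: poly_Aut_def)
  then show "\<exists>\<tau>\<in>carrier poly_Aut. \<tau> \<otimes>\<^bsub>poly_Aut\<^esub> \<sigma> = \<one>\<^bsub>poly_Aut\<^esub>"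
    using poly_Aut_inv_into(3)[OF s] by blast
qed (auto simp: poly_Aut_def bij_comp)

text \<open>Both composites are multiplicative and additive and fix constants and variables, hence
  are the identity; so an inverse has to be verified on variables only.\<close>

lemma poly_AutI:
  fixes \<sigma> \<tau> :: "('n::finite, 'k::field) mpoly_map"
  assumes s: "\<And>p q. \<sigma> (p + q) = \<sigma> p + \<sigma> q" "\<And>p q. \<sigma> (p * q) = \<sigma> p * \<sigma> q" "\<And>c. \<sigma> (Const c) = Const c"
    and t: "\<And>p q. \<tau> (p + q) = \<tau> p + \<tau> q" "\<And>p q. \<tau> (p * q) = \<tau> p * \<tau> q" "\<And>c. \<tau> (Const c) = Const c"
    and v: "\<And>i. \<sigma> (\<tau> (Var i)) = Var i" "\<And>i. \<tau> (\<sigma> (Var i)) = Var i"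
  shows "\<sigma> \<in> carrier poly_Aut"
proof -
  have "\<sigma> (\<tau> p) = p" for p
    by (induction p rule: mpoly_induct) (simp_all add: s t v)
  moreover have "\<tau> (\<sigma> p) = p" for p
    by (induction p rule: mpoly_induct) (simp_all add: s t v)
  ultimately have "bij \<sigma>" by (intro o_bij[of \<tau>]) auto
  with s show ?thesis by (simp add: poly_Aut_def)
qed

definition shear :: "'n \<Rightarrow> ('n \<Rightarrow>\<^sub>0 nat) \<Rightarrow> 'k \<Rightarrow> ('n::finite, 'k::field) mpoly_map"
  where "shear i m c =
    insertion Const (\<lambda>j. if j = i then Var i + Poly_Mapping.single m c else Var j)"

lemma shear_add: "shear i m c (p + q) = shear i m c p + shear i m c q"
  and shear_mult: "shear i m c (p * q) = shear i m c p * shear i m c q"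
  and shear_Const: "shear i m c (Const a) = Const a"
  and shear_Var: "shear i m c (Var j) = (if j = i then Var i + Poly_Mapping.single m c else Var j)"
  unfolding shear_def
  by (rule insertion_add insertion_mult insertion_Const insertion_Var; simp add: Const_add Const_mult)+

lemma shear_single:
  assumes "Poly_Mapping.lookup m i = 0"
  shows "shear i m c (Poly_Mapping.single m d) = Poly_Mapping.single m d"
proof -
  have "shear i m c (Poly_Mapping.single m d) = Const d *
      (\<Prod>j\<in>UNIV. (if j = i then Var i + Poly_Mapping.single m c else Var j) ^ Poly_Mapping.lookup m j)"
    unfolding shear_def by (rule insertion_single) (simp_all add: Const_add Const_mult)
  also have "\<dots> = Const d * (\<Prod>j\<in>UNIV. Var j ^ Poly_Mapping.lookup m j)"
    using assms by (intro arg_cong2[where f = "(*)"] prod.cong) auto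
  finally show ?thesis by (simp add: single_eq_prod_Var[of m d])
qed

text \<open>The added monomial is free of \<open>x_i\<close>, so the shear fixes it. Composing two
  such shears therefore adds their parameters, and \<open>- c\<close> gives the inverse.\<close>

lemma shear_mem_poly_Aut:
  assumes "Poly_Mapping.lookup m i = 0"
  shows "shear i m c \<in> carrier poly_Aut"
proof (rule poly_AutI[where \<tau> = "shear i m (- c)"])
  show "shear i m c (shear i m (- c) (Var j)) = Var j" for j
    by (simp add: shear_Var shear_add shear_single[OF assms] add.assoc single_add[symmetric])
  show "shear i m (- c) (shear i m c (Var j)) = Var j" for j
    by (simp add: shear_Var shear_add shear_single[OF assms] add.assoc single_add[symmetric])
qed (simp_all add: shear_add shear_mult shear_Const)

text \<open>The shear is the exponential of the locally nilpotent derivation \<open>c x\<^sup>m \<partial>\<^sub>i\<close>; only its expansion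
  to first order in \<open>c\<close> is needed.\<close>

lemma shear_expansion:
  fixes p :: "('n::finite, 'k::field) mpoly"
  shows "\<exists>F. (\<forall>c. shear i m c p = poly F (Const c)) \<and> coeff F 0 = p \<and>
    coeff F 1 = Poly_Mapping.single m 1 * pderiv i p"
proof (induction p rule: mpoly_induct)
  case (Const a)
  show ?case by (rule exI[of _ "[:Const a:]"]) (simp add: shear_Const)
next
  case (Var j)
  show ?case
  proof (cases "j = i")
    case True
    then show ?thesis
      by (intro exI[of _ "[:Var i, Poly_Mapping.single m 1:]"])
        (simp add: shear_Var pderiv_Var Const_mult_single)
  next
    case False
    then show ?thesis
      by (intro exI[of _ "[:Var j:]"]) (simp add: shear_Var pderiv_Var)
  qed
next
  case (add p q)
  then obtain F H where "\<forall>c. shear i m c p = poly F (Const c)" "coeff F 0 = p"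
      "coeff F 1 = Poly_Mapping.single m 1 * pderiv i p"
      "\<forall>c. shear i m c q = poly H (Const c)" "coeff H 0 = q"
      "coeff H 1 = Poly_Mapping.single m 1 * pderiv i q"
    by blast
  then show ?case
    by (intro exI[of _ "F + H"]) (simp add: shear_add pderiv_add ring_distribs)
next
  case (mult p q)
  then obtain F H where "\<forall>c. shear i m c p = poly F (Const c)" "coeff F 0 = p"
      "coeff F 1 = Poly_Mapping.single m 1 * pderiv i p"
      "\<forall>c. shear i m c q = poly H (Const c)" "coeff H 0 = q"
      "coeff H 1 = Poly_Mapping.single m 1 * pderiv i q"
    by blast
  \<comment> \<open>The linear coefficient of a product of expansions follows the same Leibniz rule
    as \<open>pderiv\<close>.\<close>
  then show ?case
    by (intro exI[of _ "F * H"])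
      (simp add: shear_mult pderiv_mult ring_distribs coeff_mult mult_ac add.commute)
qed

text \<open>\<open>f(2c) - 2\<^sup>n f(c)\<close> kills the leading coefficient of a polynomial \<open>f\<close> of degree \<open>n\<close>.\<close>

lemma subspace_coeffs:
  fixes V :: "('n::finite, 'k::field_char_0) mpoly set"
  assumes add: "\<And>p q. p \<in> V \<Longrightarrow> q \<in> V \<Longrightarrow> p + q \<in> V"
    and smult: "\<And>a p. p \<in> V \<Longrightarrow> Const a * p \<in> V"
    and F: "\<And>c. poly F (Const c) \<in> V"
  shows "coeff F k \<in> V"
proof -
  have 0: "0 \<in> V" using smult[OF F, of 0] by simp
  have diff: "p - q \<in> V" if "p \<in> V" "q \<in> V" for p q
    using add[OF that(1) smult[OF that(2), of "- 1"]] by (simp add: Const_minus)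
  have sum: "sum f A \<in> V" if "\<And>x. x \<in> A \<Longrightarrow> f x \<in> V" for f :: "nat \<Rightarrow> _" and A
    using that by (induction A rule: infinite_finite_induct) (auto intro: 0 add)
  \<comment> \<open>The family \<open>v\<close> has to be arbitrary: the induction step replaces
    \<open>v k\<close> by \<open>(2 ^ k - 2 ^ n) v k\<close>, with one term fewer.\<close>
  have *: "v k \<in> V" if "\<And>c. (\<Sum>k<n. Const (c ^ k) * v k) \<in> V" "k < n" for v n k
    using that
  proof (induction n arbitrary: v k)
    case (Suc n)
    define S where "S c = (\<Sum>k<Suc n. Const (c ^ k) * v k)" for c
    have S: "S c \<in> V" for c using Suc.prems(1) by (simp add: S_def)
    have "S (2 * c) - Const (2 ^ n) * S c = (\<Sum>k<n. Const (c ^ k) * (Const (2 ^ k - 2 ^ n) * v k))" for c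
    proof -
      have "S (2 * c) - Const (2 ^ n) * S c =
          (\<Sum>k<Suc n. Const ((2 * c) ^ k) * v k - Const (2 ^ n) * (Const (c ^ k) * v k))"
        by (simp only: S_def sum_distrib_left sum_subtractf)
      also have "\<dots> = (\<Sum>k<Suc n. Const (c ^ k) * (Const (2 ^ k - 2 ^ n) * v k))"
        by (intro sum.cong refl)
          (simp add: power_mult_distrib Const_mult Const_diff ring_distribs mult_ac)
      finally show ?thesis by simp
    qed
    then have "(\<Sum>k<n. Const (c ^ k) * (Const (2 ^ k - 2 ^ n) * v k)) \<in> V" for c
      using diff[OF S smult[OF S]] by metis
    note IH = Suc.IH[OF this]
    have low: "v k \<in> V" if "k < n" for k
    proof -
      have "(2::nat) ^ k \<noteq> 2 ^ n" using that by simp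
      then have "(2::'k) ^ k \<noteq> 2 ^ n"
        by (metis of_nat_eq_iff of_nat_numeral of_nat_power)
      then have "v k = Const (inverse (2 ^ k - 2 ^ n)) * (Const (2 ^ k - 2 ^ n) * v k)"
        by (simp add: Const_mult_cancel)
      also have "\<dots> \<in> V" using \<open>k < n\<close> by (intro smult IH)
      finally show ?thesis .
    qed
    \<comment> \<open>The leading coefficient, lost in the elimination, is recovered by evaluating
      at \<open>c = 1\<close>.\<close>
    have "v n = S 1 - (\<Sum>k<n. v k)" by (simp add: S_def)
    also have "\<dots> \<in> V" by (intro diff S sum low) simp
    finally show ?case using low Suc.prems(2) by (cases "k = n") auto
  qed simp
  show ?thesis
  proof (cases "k \<le> Polynomial.degree F")
    case True
    have "(\<Sum>k<Suc (Polynomial.degree F). Const (c ^ k) * coeff F k) \<in> V" for c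
      using F[of c] by (simp add: poly_altdef Const_power mult.commute lessThan_Suc_atMost)
    from *[OF this] True show ?thesis by simp
  qed (simp add: coeff_eq_0 0)
qed


section \<open>The representation on polynomials modulo constants\<close>

lemma base_field_simps [simp]:
  "carrier base_field = UNIV" "x \<oplus>\<^bsub>base_field\<^esub> y = x + y" "x \<otimes>\<^bsub>base_field\<^esub> y = x * y"
  "\<one>\<^bsub>base_field\<^esub> = 1" "\<zero>\<^bsub>base_field\<^esub> = 0"
  by (simp_all add: ring_of_type_algebra_def)

lemma field_base_field: "field base_field"
  by (rule field_from_type_algebra)

lemma cring_base_field: "cring base_field"
  by (rule cring_from_type_algebra)

lemma poly_rep_simps [simp]:
  "carrier poly_rep = UNIV" "p \<oplus>\<^bsub>poly_rep\<^esub> q = p + q" "\<zero>\<^bsub>poly_rep\<^esub> = 0"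
  "c \<odot>\<^bsub>poly_rep\<^esub> p = Const c * p" "gact poly_rep \<sigma> p = \<sigma> p"
  by (simp_all add: poly_rep_def)

interpretation poly_rep: gmodule base_field poly_Aut poly_rep
proof -
  have "abelian_group poly_rep"
    by (rule abelian_groupI) (auto simp: add_ac intro: exI[of _ "- x" for x])
  then have "module base_field poly_rep"
    by (intro moduleI cring_base_field)
      (simp_all add: Const_add Const_mult ring_distribs mult.assoc)
  then show "gmodule base_field poly_Aut poly_rep"
    by (intro gmodule.intro gmodule_axioms.intro group_poly_Aut)
      (auto simp: poly_AutD, simp_all add: poly_Aut_def)
qed

lemma poly_rep_minus [simp]: "p \<ominus>\<^bsub>poly_rep\<^esub> q = p - q"
proof -
  have "\<ominus>\<^bsub>poly_rep\<^esub> q = - q"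
    by (rule poly_rep.M.minus_equality) simp_all
  then show ?thesis by (simp add: poly_rep.M.minus_eq)
qed

lemma gsubmodule_range_Const: "gsubmodule base_field poly_Aut poly_rep (range Const)"
proof (rule poly_rep.gsubmoduleI)
  show "\<zero>\<^bsub>poly_rep\<^esub> \<in> range Const" by (metis Const_0 poly_rep_simps(3) rangeI)
qed (auto simp: poly_AutD(4) simp flip: Const_add Const_mult)

lemma poly_gsubmoduleD:
  assumes "gsubmodule base_field poly_Aut poly_rep V"
  shows "p \<in> V \<Longrightarrow> q \<in> V \<Longrightarrow> p + q \<in> V" and "p \<in> V \<Longrightarrow> Const a * p \<in> V"
    and "\<sigma> \<in> carrier poly_Aut \<Longrightarrow> p \<in> V \<Longrightarrow> \<sigma> p \<in> V"
proof -
  interpret V: abelian_subgroup V poly_rep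
    using assms by (rule poly_rep.gsubmodule_abelian_subgroup)
  show "p + q \<in> V" if "p \<in> V" "q \<in> V"
    using V.a_closed[OF that] by simp
  show "p \<in> V \<Longrightarrow> Const a * p \<in> V"
    using poly_rep.gsubmodule_smult[OF assms, of a p] by simp
  show "\<sigma> \<in> carrier poly_Aut \<Longrightarrow> p \<in> V \<Longrightarrow> \<sigma> p \<in> V"
    using poly_rep.gsubmodule_gact[OF assms, of \<sigma> p] by simp
qed

section \<open>Submodules containing a nonconstant polynomial\<close>

lemma gsubmodule_single_mult_pderiv:
  fixes V :: "('n::finite, 'k::field_char_0) mpoly set"
  assumes V: "gsubmodule base_field poly_Aut poly_rep V"
    and p: "p \<in> V" and m: "Poly_Mapping.lookup m i = 0"
  shows "Poly_Mapping.single m 1 * pderiv i p \<in> V"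
proof -
  note D = poly_gsubmoduleD[OF V]
  obtain F where F: "\<And>c. shear i m c p = poly F (Const c)"
    "coeff F 1 = Poly_Mapping.single m 1 * pderiv i p"
    using shear_expansion[of i m p] by blast
  have "poly F (Const c) \<in> V" for c
    using D(3)[OF shear_mem_poly_Aut[OF m] p] F(1) by metis
  from subspace_coeffs[where k = 1, OF D(1,2) this] show ?thesis by (simp only: F(2))
qed

text \<open>For the exponent 0 the shears are the translations of one variable.\<close>

lemma gsubmodule_pderiv:
  fixes V :: "('n::finite, 'k::field_char_0) mpoly set"
  assumes "gsubmodule base_field poly_Aut poly_rep V" "p \<in> V"
  shows "pderiv i p \<in> V"
  using gsubmodule_single_mult_pderiv[OF assms, of 0 i] by simp

text \<open>Induction on a bound for the total degree: as long as some partial derivative is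
  nonconstant, pass to it. Otherwise all of them are constant, and one is nonzero because the
  polynomial itself is not constant.\<close>

lemma gsubmodule_nonconstant_pderiv:
  fixes V :: "('n::finite, 'k::field_char_0) mpoly set"
  assumes V: "gsubmodule base_field poly_Aut poly_rep V"
    and p: "p \<in> V" "p \<notin> range Const"
  shows "\<exists>l\<in>V. \<exists>j b. b \<noteq> 0 \<and> pderiv j l = Const b"
proof -
  have "\<exists>l\<in>V. \<exists>j b. b \<noteq> 0 \<and> pderiv j l = Const b"
    if "p \<in> V" "p \<notin> range Const"
      "\<And>m. m \<in> Poly_Mapping.keys p \<Longrightarrow> (\<Sum>i\<in>UNIV. Poly_Mapping.lookup m i) \<le> d" for p d
    using that
  proof (induction d arbitrary: p)
    case 0
    have "pderiv i p = 0" for i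
    proof (rule poly_mapping_eqI)
      fix m
      have "m + Poly_Mapping.single i 1 \<notin> Poly_Mapping.keys p"
        using "0.prems"(3)[of "m + Poly_Mapping.single i 1"]
          member_le_sum[of i UNIV "Poly_Mapping.lookup (m + Poly_Mapping.single i 1)"]
        by (auto simp: lookup_add)
      then show "Poly_Mapping.lookup (pderiv i p) m = Poly_Mapping.lookup 0 m"
        by (simp add: lookup_pderiv in_keys_iff)
    qed
    then show ?case using "0.prems"(2) by (metis pderiv_eq_0_imp_Const rangeI)
  next
    case (Suc d)
    show ?case
    proof (cases "\<forall>i. pderiv i p \<in> range Const")
      case True
      obtain j where j: "pderiv j p \<noteq> 0"
        using Suc.prems(2) by (metis pderiv_eq_0_imp_Const rangeI)
      obtain b where "pderiv j p = Const b" using True by blast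
      with j Suc.prems(1) show ?thesis by (intro bexI[of _ p] exI[of _ j] exI[of _ b]) auto
    next
      case False
      then obtain i where i: "pderiv i p \<notin> range Const" by blast
      show ?thesis
      proof (rule Suc.IH[OF gsubmodule_pderiv[OF V Suc.prems(1)] i])
        fix m assume "m \<in> Poly_Mapping.keys (pderiv i p)"
        then have "m + Poly_Mapping.single i 1 \<in> Poly_Mapping.keys p"
          by (auto simp: lookup_pderiv in_keys_iff)
        moreover have "(\<Sum>k\<in>UNIV. Poly_Mapping.lookup (Poly_Mapping.single i (1::nat)) k) = 1"
          by (simp add: lookup_single when_def)
        ultimately show "(\<Sum>i\<in>UNIV. Poly_Mapping.lookup m i) \<le> d"
          using Suc.prems(3)[of "m + Poly_Mapping.single i 1"]
          by (simp only: lookup_add sum.distrib) simp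
      qed
    qed
  qed
  moreover have "\<exists>d. \<forall>m\<in>Poly_Mapping.keys p. (\<Sum>i\<in>UNIV. Poly_Mapping.lookup m i) \<le> d"
    using finite_nat_set_iff_bounded_le[of "(\<lambda>m. \<Sum>i\<in>UNIV. Poly_Mapping.lookup m i) ` Poly_Mapping.keys p"]
    by auto
  ultimately show ?thesis using p by blast
qed

lemma gsubmodule_eq_UNIV:
  fixes V :: "('n::finite, 'k::field_char_0) mpoly set"
  assumes n: "CARD('n) \<ge> 2" and V: "gsubmodule base_field poly_Aut poly_rep V"
    and p: "p \<in> V" "p \<notin> range Const"
  shows "V = UNIV"
proof -
  note D = poly_gsubmoduleD[OF V]
  note E = gsubmodule_single_mult_pderiv[OF V]
  obtain l j b where l: "l \<in> V" "b \<noteq> 0" "pderiv j l = Const b"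
    using gsubmodule_nonconstant_pderiv[OF V p] by blast
  \<comment> \<open>The derivation \<open>x^m \<partial>\<^sub>j\<close> maps \<open>l\<close> to
    \<open>b\<close> times \<open>x^m\<close>. It is available exactly for those \<open>m\<close>
    that are free of \<open>x_j\<close>.\<close>
  have no_j: "Poly_Mapping.single m 1 \<in> V" if "Poly_Mapping.lookup m j = 0" for m
  proof -
    have "Const (inverse b) * (Const b * Poly_Mapping.single m 1) \<in> V"
      using D(2)[OF E[OF l(1) that], where a = "inverse b"] l(3) by (simp add: mult.commute)
    then show ?thesis by (simp only: Const_mult_cancel[OF l(2)])
  qed
  \<comment> \<open>Monomials containing \<open>x_j\<close> are reached through a second
    variable.\<close>
  have "\<exists>i. i \<noteq> j"
  proof (rule ccontr)
    assume "\<not> ?thesis"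
    then have "UNIV = {j}" by auto
    then have "CARD('n) = card {j}" by (rule arg_cong)
    with n show False by simp
  qed
  then obtain i where ij: "i \<noteq> j" by blast
  have monomial: "Poly_Mapping.single m 1 \<in> V" if "Poly_Mapping.lookup m j = k" for m k
    using that
  proof (induction k arbitrary: m)
    case 0 then show ?case by (rule no_j)
  next
    case (Suc k)
    let ?ej = "Poly_Mapping.single j (1::nat)" and ?ei = "Poly_Mapping.single i (1::nat)"
    have m: "m - ?ej + ?ej = m"
      using Suc.prems by (intro poly_mapping_eqI) (auto simp: lookup_add lookup_minus lookup_single when_def)
    \<comment> \<open>One factor \<open>x_j\<close> is traded for a factor \<open>x_i\<close>, which
      lowers the exponent of \<open>x_j\<close>. The derivation
      \<open>x_j \<partial>\<^sub>i\<close> trades it back and contributes the nonzero factor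
      \<open>?a\<close>.\<close>
    let ?m = "m - ?ej + ?ei" and ?a = "of_nat (Suc (Poly_Mapping.lookup m i)) :: 'k"
    have "Poly_Mapping.single ?m 1 \<in> V"
      using Suc.prems ij by (intro Suc.IH) (simp add: lookup_add lookup_minus lookup_single)
    then have "Poly_Mapping.single ?ej 1 * pderiv i (Poly_Mapping.single ?m 1) \<in> V"
      using ij by (intro E) (simp_all add: lookup_single)
    also have "Poly_Mapping.single ?ej 1 * pderiv i (Poly_Mapping.single ?m 1) =
        Const ?a * Poly_Mapping.single m (1::'k)"
      using ij m by (simp add: pderiv_single lookup_add lookup_minus lookup_single mult_single
          Const_mult_single add.commute del: of_nat_Suc)
    finally have "Const (inverse ?a) * (Const ?a * Poly_Mapping.single m 1) \<in> V" by (rule D(2))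
    then show ?case by (simp only: Const_mult_cancel[OF of_nat_neq_0])
  qed
  have "q \<in> V" for q
  proof (induction q rule: mpoly_add_induct)
    case zero show ?case using D(2)[OF p(1), where a = 0] by simp
  next
    case (single m c)
    show ?case using D(2)[OF monomial[OF refl, of m], where a = c] by (simp add: Const_mult_single)
  next
    case (add p q) then show ?case by (rule D(1))
  qed
  then show ?thesis by blast
qed

lemma Var_notin_range_Const: "(Var i :: ('n, 'k::field) mpoly) \<notin> range Const"
proof
  assume "(Var i :: ('n, 'k) mpoly) \<in> range Const"
  then obtain c where "(Var i :: ('n, 'k) mpoly) = Const c" by blast
  then have "pderiv i (Var i :: ('n, 'k) mpoly) = pderiv i (Const c)" by simp
  then show False by (simp add: pderiv_Var)
qed

lemma simple_poly_mod_const: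
  assumes "CARD('n::finite) \<ge> 2"
  shows "simple_gmodule base_field poly_Aut (poly_mod_const :: ('n, 'k::field_char_0) poly_quotient)"
  unfolding poly_mod_const_def
proof (rule poly_rep.simple_quotientI[OF gsubmodule_range_Const])
  show "range Const \<noteq> carrier (poly_rep :: (('n, 'k) mpoly_map, 'k, ('n, 'k) mpoly) gmodule)"
    by (simp, metis UNIV_I Var_notin_range_Const)
  show "V = carrier poly_rep" if "gsubmodule base_field poly_Aut poly_rep V" "range Const \<subseteq> V" "V \<noteq> range Const"
    for V :: "('n, 'k) mpoly set"
    using that gsubmodule_eq_UNIV[OF assms that(1)] by auto
qed

section \<open>Endomorphisms of polynomials modulo constants\<close>

lemma poly_coset_eq_iff:
  "range Const +>\<^bsub>poly_rep\<^esub> p = range Const +>\<^bsub>poly_rep\<^esub> q \<longleftrightarrow> p - q \<in> range Const"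
  using poly_rep.coset_eq_iff[OF gsubmodule_range_Const, of p q] by simp

text \<open>An equivariant endomorphism maps the class of \<open>Var i\<close> to a class that is fixed by all shears
  fixing the class of \<open>Var i\<close>, and those are only the multiples of the class of \<open>Var i\<close>.\<close>

lemma poly_mod_const_End_scalar:
  fixes f :: "('n::finite, 'k::field_char_0) mpoly set \<Rightarrow> ('n, 'k) mpoly set"
  assumes n: "CARD('n) \<ge> 2" and f: "f \<in> gmodule_hom base_field poly_Aut poly_mod_const poly_mod_const"
  shows "\<exists>a\<in>carrier base_field. \<forall>C\<in>carrier poly_mod_const. f C = a \<odot>\<^bsub>poly_mod_const\<^esub> C"
proof -
  let ?Q = "poly_mod_const :: ('n, 'k) poly_quotient" and ?K = "range Const :: ('n, 'k) mpoly set"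
  interpret Q: simple_gmodule base_field poly_Aut ?Q
    by (rule simple_poly_mod_const[OF n])
  note K = gsubmodule_range_Const
  note KD = poly_gsubmoduleD[OF K]
  note q = poly_rep.quotient_carrier[OF K, folded poly_mod_const_def]
    poly_rep.quotient_gact[OF K, folded poly_mod_const_def]
    poly_rep.quotient_smult[OF K, folded poly_mod_const_def]
  obtain i :: 'n where True by blast
  let ?c = "\<lambda>p. ?K +>\<^bsub>poly_rep\<^esub> p"
  have "f (?c (Var i)) \<in> carrier ?Q"
    by (rule gmodule_homD(1)[OF f]) (simp add: q)
  then obtain p where p: "f (?c (Var i)) = ?c p" by (auto simp: q)
  \<comment> \<open>The first-order consequence of invariance: if the shears fix the class of
    \<open>Var i\<close>, they fix that of \<open>p\<close>, and the linear coefficient in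
    \<open>c\<close> of \<open>shear j m c p - p\<close> is then constant.\<close>
  have fixed: "Poly_Mapping.single m 1 * pderiv j p \<in> ?K"
    if m: "Poly_Mapping.lookup m j = 0" and v: "\<And>c. shear j m c (Var i) - Var i \<in> ?K" for j m
  proof -
    obtain F where F: "\<And>c. shear j m c p = poly F (Const c)"
      "coeff F 1 = Poly_Mapping.single m 1 * pderiv j p"
      using shear_expansion[of j m p] by blast
    have "poly (F - [:p:]) (Const c) \<in> ?K" for c
    proof -
      have s: "shear j m c \<in> carrier poly_Aut" by (rule shear_mem_poly_Aut[OF m])
      have "?c (shear j m c p) = gact ?Q (shear j m c) (f (?c (Var i)))"
        using s by (simp add: p q)
      also have "\<dots> = f (gact ?Q (shear j m c) (?c (Var i)))"
        by (rule gmodule_homD(4)[OF f s, symmetric]) (simp add: q)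
      also have "gact ?Q (shear j m c) (?c (Var i)) = ?c (Var i)"
        using s v by (simp add: q poly_coset_eq_iff)
      finally have "shear j m c p - p \<in> ?K" by (simp add: p poly_coset_eq_iff)
      then show ?thesis by (simp add: F)
    qed
    from subspace_coeffs[where k = 1, OF KD(1,2) this] have "coeff F 1 - coeff [:p:] 1 \<in> ?K"
      by (simp only: coeff_diff)
    then show ?thesis by (simp only: F(2)) simp
  qed
  \<comment> \<open>Translations change a variable by a constant at most, so they fix its class.
    Hence \<open>p\<close> has constant partial derivatives.\<close>
  have "pderiv j p \<in> ?K" for j
  proof -
    have "shear j 0 c (Var i) - Var i \<in> ?K" for c
      using rangeI[of Const c] rangeI[of Const 0] by (auto simp: shear_Var Const_def)
    then show ?thesis using fixed[of 0 j] by simp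
  qed
  then have "\<forall>j. \<exists>c. pderiv j p = Const c" by blast
  then obtain b where b: "\<And>j. pderiv j p = Const (b j)" by metis
  \<comment> \<open>Adding \<open>c x_i\<close> to \<open>x_j\<close> leaves \<open>x_i\<close>
    alone. So \<open>b j\<close> times \<open>x_i\<close> must be constant, and differentiating
    along \<open>x_i\<close> gives \<open>b j = 0\<close>.\<close>
  have "b j = 0" if "j \<noteq> i" for j
  proof -
    have "shear j (Poly_Mapping.single i 1) c (Var i) - Var i \<in> ?K" for c
      using that rangeI[of Const 0] by (simp add: shear_Var)
    then have "Poly_Mapping.single (Poly_Mapping.single i 1) 1 * pderiv j p \<in> ?K"
      using that by (intro fixed) (simp add: lookup_single)
    then obtain d where "Var i * Const (b j) = Const d" by (auto simp: b Var_def)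
    then have "pderiv i (Var i * Const (b j)) = pderiv i (Const d)" by simp
    then show ?thesis by (simp add: pderiv_mult pderiv_Var)
  qed
  then have "pderiv j (p - Const (b i) * Var i) = 0" for j
    using pderiv_add[of j "p - Const (b i) * Var i" "Const (b i) * Var i"]
    by (cases "j = i") (simp_all add: b pderiv_mult pderiv_Var)
  then have "p - Const (b i) * Var i \<in> ?K"
    by (metis pderiv_eq_0_imp_Const rangeI)
  then have "f (?c (Var i)) = b i \<odot>\<^bsub>?Q\<^esub> ?c (Var i)"
    by (simp add: p q poly_coset_eq_iff)
  moreover have "?c (Var i) \<noteq> \<zero>\<^bsub>?Q\<^esub>"
    using poly_rep.coset_eq_self_iff[OF K, of "Var i"]
    by (simp add: poly_mod_const_def poly_rep.quotient_zero[OF K] Var_notin_range_Const)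
  moreover have "?c (Var i) \<in> carrier ?Q" by (simp add: q)
  ultimately have "f C = b i \<odot>\<^bsub>?Q\<^esub> C" if "C \<in> carrier ?Q" for C
    using Q.hom_eq_smult_of_eigenvector[OF f, of "b i" "?c (Var i)" C] that
    by (simp only: base_field_simps UNIV_I simp_thms)
  then show ?thesis by (intro bexI[of _ "b i"]) auto
qed

section \<open>Derivatives of determinants\<close>

lemma derivation_prod:
  fixes d :: "'a::comm_ring_1 \<Rightarrow> 'a"
  assumes one: "d 1 = 0" and mult: "\<And>x y. d (x * y) = d x * y + x * d y"
    and "finite S"
  shows "d (prod f S) = (\<Sum>k\<in>S. \<Prod>i\<in>S. if i = k then d (f i) else f i)"
  using \<open>finite S\<close>
proof (induction S rule: finite_induct)
  case (insert x S)
  have "(\<Prod>i\<in>S. if i = x then d (f i) else f i) = prod f S"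
    using insert.hyps by (intro prod.cong) auto
  moreover have "(\<Sum>k\<in>S. \<Prod>i\<in>insert x S. if i = k then d (f i) else f i) =
      f x * (\<Sum>k\<in>S. \<Prod>i\<in>S. if i = k then d (f i) else f i)"
    unfolding sum_distrib_left using insert.hyps by (intro sum.cong) auto
  ultimately show ?case
    using insert by (simp add: mult)
qed (simp add: one)

text \<open>The product rule in each term of the Leibniz expansion, regrouped by the row that is
  differentiated. Signs behave as constants because \<open>d (- 1) = 0\<close>.\<close>

lemma derivation_det:
  fixes d :: "'a::comm_ring_1 \<Rightarrow> 'a" and A :: "'a^'n^'n"
  assumes one: "d 1 = 0" and add: "\<And>x y. d (x + y) = d x + d y"
    and mult: "\<And>x y. d (x * y) = d x * y + x * d y"
  shows "d (det A) = (\<Sum>k\<in>UNIV. det (\<chi> i. if i = k then (\<chi> j. d (A $ i $ j)) else A $ i))"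
proof -
  have zero: "d 0 = 0" using add[of 0 0] by simp
  have sum: "d (sum f S) = (\<Sum>x\<in>S. d (f x))" for f :: "('n \<Rightarrow> 'n) \<Rightarrow> 'a" and S
    by (induction S rule: infinite_finite_induct) (simp_all add: zero add)
  have neg: "d (- 1) = 0" using add[of "- 1" 1] by (simp add: zero one)
  have sign: "d (of_int (sign p) * x) = of_int (sign p) * d x" for p :: "'n \<Rightarrow> 'n" and x
    by (auto simp: sign_def mult one neg)
  have "d (det A) = (\<Sum>p | p permutes UNIV. \<Sum>k\<in>UNIV. of_int (sign p) *
      (\<Prod>i\<in>UNIV. if i = k then d (A $ i $ p i) else A $ i $ p i))"
    unfolding det_def sum sign by (simp add: derivation_prod[OF one mult] sum_distrib_left)
  also have "\<dots> = (\<Sum>k\<in>UNIV. \<Sum>p | p permutes UNIV. of_int (sign p) *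
      (\<Prod>i\<in>UNIV. if i = k then d (A $ i $ p i) else A $ i $ p i))"
    by (rule sum.swap)
  also have "\<dots> = (\<Sum>k\<in>UNIV. det (\<chi> i. if i = k then (\<chi> j. d (A $ i $ j)) else A $ i))"
    unfolding det_def by (intro sum.cong arg_cong2[where f = "(*)"] prod.cong refl) simp
  finally show ?thesis .
qed

text \<open>By linearity in row \<open>k\<close>, each summand with \<open>l \<noteq> k\<close> has
  two equal rows and vanishes; only the multiple of the original row survives.\<close>

lemma det_replace_row:
  fixes A :: "'a::comm_ring_1^'n^'n"
  shows "det (\<chi> i. if i = k then (\<Sum>l\<in>UNIV. b l *s A $ l) else A $ i) = b k * det A"
proof -
  have "det (\<chi> i. if i = k then (\<Sum>l\<in>UNIV. b l *s A $ l) else A $ i) =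
      (\<Sum>l\<in>UNIV. det (\<chi> i. if i = k then b l *s A $ l else A $ i))"
    by (rule det_linear_row_sum[OF finite])
  also have "\<dots> = (\<Sum>l\<in>UNIV. if l = k then b k * det A else 0)"
  proof (rule sum.cong[OF refl])
    fix l
    have eq: "det (\<chi> i. if i = k then b l *s A $ l else A $ i) =
        b l * det (\<chi> i. if i = k then A $ l else A $ i)"
      by (rule det_row_mul)
    show "det (\<chi> i. if i = k then b l *s A $ l else A $ i) = (if l = k then b k * det A else 0)"
    proof (cases "l = k")
      case True
      then have "(\<chi> i. if i = k then A $ l else A $ i) = A" by (simp add: vec_eq_iff)
      with eq True show ?thesis by simp
    next
      case False
      have "det (\<chi> i. if i = k then A $ l else A $ i) = 0"
        by (rule det_identical_rows[OF False]) (use False in \<open>simp add: row_def\<close>)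
      with eq False show ?thesis by simp
    qed
  qed
  also have "\<dots> = b k * det A" by simp
  finally show ?thesis .
qed

text \<open>Since \<open>B\<close> is a left inverse of \<open>A\<close>, every differentiated row
  is a combination of the rows of \<open>A\<close>, with coefficients from the product of the
  differentiated matrix and \<open>B\<close>. Replacing row \<open>k\<close> picks out the diagonal
  coefficient, and the sum is a trace. The argument is purely algebraic, for a derivation of a
  commutative ring.\<close>

lemma jacobi_formula:
  fixes d :: "'a::comm_ring_1 \<Rightarrow> 'a" and A B :: "'a^'n^'n"
  assumes "d 1 = 0" "\<And>x y. d (x + y) = d x + d y" "\<And>x y. d (x * y) = d x * y + x * d y"
    and BA: "B ** A = mat 1"
  shows "d (det A) = (\<Sum>k\<in>UNIV. \<Sum>j\<in>UNIV. d (A $ k $ j) * B $ j $ k) * det A"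
proof -
  have BA': "(\<Sum>l\<in>UNIV. B $ j $ l * A $ l $ i) = (if j = i then 1 else 0)" for j i
    using arg_cong[OF BA, of "\<lambda>M. M $ j $ i"] by (simp add: matrix_matrix_mult_def mat_def)
  have row: "(\<chi> j. d (A $ k $ j)) = (\<Sum>l\<in>UNIV. (\<Sum>j\<in>UNIV. d (A $ k $ j) * B $ j $ l) *s A $ l)" for k
  proof (rule vec_eq_iff[THEN iffD2], rule allI)
    fix i
    have "(\<Sum>l\<in>UNIV. (\<Sum>j\<in>UNIV. d (A $ k $ j) * B $ j $ l) *s A $ l) $ i =
        (\<Sum>l\<in>UNIV. \<Sum>j\<in>UNIV. d (A $ k $ j) * (B $ j $ l * A $ l $ i))"
      by (simp add: sum_component sum_distrib_right mult.assoc)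
    also have "\<dots> = (\<Sum>j\<in>UNIV. d (A $ k $ j) * (\<Sum>l\<in>UNIV. B $ j $ l * A $ l $ i))"
      by (subst sum.swap) (simp add: sum_distrib_left)
    also have "\<dots> = d (A $ k $ i)"
      by (simp add: BA' mult_delta_right)
    finally show "(\<chi> j. d (A $ k $ j)) $ i =
        (\<Sum>l\<in>UNIV. (\<Sum>j\<in>UNIV. d (A $ k $ j) * B $ j $ l) *s A $ l) $ i" by simp
  qed
  have "d (det A) = (\<Sum>k\<in>UNIV. det (\<chi> i. if i = k then (\<chi> j. d (A $ k $ j)) else A $ i))"
    unfolding derivation_det[OF assms(1-3)]
    by (intro sum.cong refl arg_cong[where f = det]) (simp add: vec_eq_iff)
  also have "\<dots> = (\<Sum>k\<in>UNIV. (\<Sum>j\<in>UNIV. d (A $ k $ j) * B $ j $ k) * det A)"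
    unfolding row det_replace_row ..
  finally show ?thesis by (simp add: sum_distrib_right)
qed


section \<open>Equivariance of the divergence\<close>

definition conj_Der :: "('n, 'k::field) mpoly_map \<Rightarrow> ('n, 'k) mpoly_map \<Rightarrow> ('n, 'k) mpoly_map"
  where "conj_Der \<sigma> \<delta> = \<sigma> \<circ> \<delta> \<circ> inv_into UNIV \<sigma>"

lemma conj_Der_mem_poly_Der:
  assumes s: "\<sigma> \<in> carrier poly_Aut" and d: "\<delta> \<in> poly_Der"
  shows "conj_Der \<sigma> \<delta> \<in> poly_Der"
  using poly_AutD[OF s] poly_AutD[OF poly_Aut_inv_into(3)[OF s]] poly_DerD[OF d] poly_Aut_inv_into(2)[OF s]
  by (simp add: poly_Der_def conj_Der_def)

lemma conj_Der_apply:
  "\<sigma> \<in> carrier poly_Aut \<Longrightarrow> conj_Der \<sigma> \<delta> (\<sigma> p) = \<sigma> (\<delta> p)"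
  by (simp add: conj_Der_def poly_Aut_inv_into)

lemma pderiv_pderiv_commute: "pderiv i (pderiv j p) = pderiv j (pderiv i p)"
  by (rule poly_mapping_eqI)
    (simp add: lookup_pderiv lookup_add lookup_single when_def add_ac mult_ac del: of_nat_Suc)

text \<open>The matrix \<open>A\<close> in the proof is the inverse of the Jacobian matrix \<open>B\<close> of \<open>\<sigma>\<close>. Its determinant is
  a unit of the polynomial ring, hence constant, and by Jacobi's formula the divergence of the
  conjugated \<open>\<partial>\<^sub>j\<close> is the logarithmic derivative of that determinant.\<close>

lemma divergence_conj_pderiv:
  fixes \<sigma> :: "('n::finite, 'k::field) mpoly_map"
  assumes s: "\<sigma> \<in> carrier poly_Aut"
  shows "divergence (conj_Der \<sigma> (pderiv j)) = 0"
proof -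
  \<comment> \<open>In the coordinates \<open>y\<close>, the derivation \<open>e k\<close> is the
    partial derivative along \<open>y k\<close>.\<close>
  define e where "e k = conj_Der \<sigma> (pderiv k)" for k
  define y where "y k = \<sigma> (Var k)" for k
  have e: "e k \<in> poly_Der" for k
    unfolding e_def by (rule conj_Der_mem_poly_Der[OF s pderiv_mem_poly_Der])
  have ey: "e k (y l) = (if k = l then 1 else 0)" for k l
    unfolding e_def y_def
    by (simp add: conj_Der_apply[OF s] pderiv_Var poly_Aut_one[OF s] poly_Aut_zero[OF s])
  have comm: "e k (e l p) = e l (e k p)" for k l p
    unfolding e_def conj_Der_def by (simp add: poly_Aut_inv_into[OF s] pderiv_pderiv_commute)
  have e_sum: "e k p = (\<Sum>i\<in>UNIV. e k (Var i) * pderiv i p)" for k p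
    by (rule poly_Der_eq_sum_pderiv[OF e])
  define A :: "('n, 'k) mpoly^'n^'n" where "A = (\<chi> k i. e k (Var i))"
  define B :: "('n, 'k) mpoly^'n^'n" where "B = (\<chi> i k. pderiv i (y k))"
  have AB: "A ** B = mat 1"
    by (simp add: vec_eq_iff matrix_matrix_mult_def mat_def A_def B_def e_sum[symmetric] ey)
  \<comment> \<open>The chain rule for the coordinates \<open>y\<close>, obtained by expanding the
    conjugate of \<open>pderiv i\<close> under the inverse automorphism and applying
    \<open>\<sigma>\<close> to the result.\<close>
  have pderiv_sum: "pderiv i p = (\<Sum>k\<in>UNIV. pderiv i (y k) * e k p)" for i p
  proof -
    let ?i = "inv_into UNIV \<sigma>"
    note si = poly_Aut_inv_into(3)[OF s]
    define d where "d = conj_Der ?i (pderiv i)"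
    have sp: "inv_into UNIV ?i = \<sigma>"
      using poly_AutD(1)[OF s] by (rule inv_inv_eq)
    have "d \<in> poly_Der" unfolding d_def
      by (rule conj_Der_mem_poly_Der[OF si pderiv_mem_poly_Der])
    then have "d (?i p) = (\<Sum>k\<in>UNIV. d (Var k) * pderiv k (?i p))"
      by (rule poly_Der_eq_sum_pderiv)
    then have "\<sigma> (d (?i p)) = (\<Sum>k\<in>UNIV. \<sigma> (d (Var k)) * \<sigma> (pderiv k (?i p)))"
      by (simp add: poly_Aut_sum[OF s] poly_AutD(3)[OF s])
    then show ?thesis
      by (simp add: d_def conj_Der_def sp poly_Aut_inv_into[OF s] y_def e_def)
  qed
  have BA: "B ** A = mat 1"
    by (simp add: vec_eq_iff matrix_matrix_mult_def mat_def A_def B_def pderiv_sum[symmetric] pderiv_Var)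
  have unit: "det A * det B = 1"
    using det_mul[of A B] by (simp add: AB)
  obtain c where c: "det A = Const c"
    using mpoly_unit_imp_Const[OF unit] by blast
  have "divergence (e j) = (\<Sum>i\<in>UNIV. \<Sum>k\<in>UNIV. pderiv i (y k) * e k (e j (Var i)))"
    by (simp add: divergence_eq[OF e] pderiv_sum[of _ "e j _"])
  \<comment> \<open>Commuting \<open>e k\<close> past \<open>e j\<close> turns the sum into the
    trace in Jacobi's formula for \<open>e j\<close> and \<open>A\<close>.\<close>
  also have "\<dots> = (\<Sum>k\<in>UNIV. \<Sum>i\<in>UNIV. e j (A $ k $ i) * B $ i $ k)"
    by (subst sum.swap) (simp add: A_def B_def comm[of j] mult.commute)
  finally have "divergence (e j) * det A = e j (det A)"
    using jacobi_formula[of "e j" B A, OF _ _ _ BA] poly_DerD(1,3)[OF e]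
      poly_Der_Const[OF e, of j 1] by simp
  also have "\<dots> = 0" by (simp add: c poly_Der_Const[OF e])
  finally have "divergence (e j) * (det A * det B) = 0" by (simp add: mult.assoc[symmetric])
  then show ?thesis by (simp add: unit e_def)
qed

text \<open>The conjugate is a combination of the derivations \<open>e k\<close> with coefficients
  \<open>\<sigma> (\<delta> (Var k))\<close>. As the \<open>e k\<close> have divergence zero, only
  the terms in which \<open>e k\<close> differentiates its own coefficient remain.\<close>

lemma divergence_conj_Der:
  fixes \<sigma> :: "('n::finite, 'k::field) mpoly_map"
  assumes s: "\<sigma> \<in> carrier poly_Aut" and d: "\<delta> \<in> poly_Der"
  shows "divergence (conj_Der \<sigma> \<delta>) = \<sigma> (divergence \<delta>)"
proof -
  define e where "e k = conj_Der \<sigma> (pderiv k)" for k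
  have e: "e k \<in> poly_Der" for k
    unfolding e_def by (rule conj_Der_mem_poly_Der[OF s pderiv_mem_poly_Der])
  have e_sum: "e k p = (\<Sum>i\<in>UNIV. e k (Var i) * pderiv i p)" for k p
    by (rule poly_Der_eq_sum_pderiv[OF e])
  let ?a = "\<lambda>k. \<sigma> (\<delta> (Var k))"
  have expand: "conj_Der \<sigma> \<delta> p = (\<Sum>k\<in>UNIV. ?a k * e k p)" for p
    using poly_Der_eq_sum_pderiv[OF d, of "inv_into UNIV \<sigma> p"]
    by (simp add: conj_Der_def e_def poly_Aut_sum[OF s] poly_AutD(3)[OF s])
  have "divergence (conj_Der \<sigma> \<delta>) =
      (\<Sum>i\<in>UNIV. \<Sum>k\<in>UNIV. pderiv i (?a k) * e k (Var i) + ?a k * pderiv i (e k (Var i)))"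
    by (simp add: divergence_eq[OF conj_Der_mem_poly_Der[OF s d]] expand
        poly_Der_sum[OF pderiv_mem_poly_Der] pderiv_mult)
  also have "\<dots> = (\<Sum>k\<in>UNIV. e k (?a k) + ?a k * divergence (e k))"
    by (subst sum.swap)
      (simp add: sum.distrib sum_distrib_left[symmetric] divergence_eq[OF e] e_sum[of _ "\<sigma> _"] mult.commute)
  also have "\<dots> = (\<Sum>k\<in>UNIV. \<sigma> (pderiv k (\<delta> (Var k))))"
    by (simp add: e_def divergence_conj_pderiv[OF s] conj_Der_apply[OF s])
  also have "\<dots> = \<sigma> (divergence \<delta>)"
    by (simp add: divergence_eq[OF d] poly_Aut_sum[OF s])
  finally show ?thesis .
qed

section \<open>The representation on derivations and the divergence as an equivariant map\<close>

lemma Der_rep_simps [simp]: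
  "carrier Der_rep = poly_Der" "\<delta> \<oplus>\<^bsub>Der_rep\<^esub> \<epsilon> = (\<lambda>p. \<delta> p + \<epsilon> p)" "\<zero>\<^bsub>Der_rep\<^esub> = (\<lambda>p. 0)"
  "c \<odot>\<^bsub>Der_rep\<^esub> \<delta> = (\<lambda>p. Const c * \<delta> p)" "gact Der_rep \<sigma> \<delta> = conj_Der \<sigma> \<delta>"
  by (simp_all add: Der_rep_def conj_Der_def)

interpretation Der_rep: gmodule base_field poly_Aut Der_rep
proof -
  have uminus: "(\<lambda>p. - \<delta> p) \<in> poly_Der" if "\<delta> \<in> poly_Der" for \<delta> :: "('n, 'k::field) mpoly_map"
    using poly_DerD[OF that] by (simp add: poly_Der_def)
  have plus: "(\<lambda>p. \<delta> p + \<epsilon> p) \<in> poly_Der" if "\<delta> \<in> poly_Der" "\<epsilon> \<in> poly_Der" for \<delta> \<epsilon> :: "('n, 'k::field) mpoly_map"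
    using poly_DerD[OF that(1)] poly_DerD[OF that(2)] by (simp add: poly_Der_def ring_distribs add_ac)
  have smult: "(\<lambda>p. Const c * \<delta> p) \<in> poly_Der" if "\<delta> \<in> poly_Der" for c and \<delta> :: "('n, 'k::field) mpoly_map"
    using poly_DerD[OF that] by (simp add: poly_Der_def ring_distribs mult_ac)
  have "abelian_group (Der_rep :: (('n, 'k::field) mpoly_map, 'k, ('n, 'k) mpoly_map) gmodule)"
  proof (rule abelian_groupI)
    fix \<delta> :: "('n, 'k) mpoly_map" assume "\<delta> \<in> carrier Der_rep"
    then show "\<exists>\<epsilon>\<in>carrier Der_rep. \<epsilon> \<oplus>\<^bsub>Der_rep\<^esub> \<delta> = \<zero>\<^bsub>Der_rep\<^esub>"
      by (intro bexI[of _ "\<lambda>p. - \<delta> p"]) (simp_all add: uminus)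
  qed (simp_all add: plus add_ac, simp add: poly_Der_def)
  then have "module base_field (Der_rep :: (('n, 'k::field) mpoly_map, 'k, ('n, 'k) mpoly_map) gmodule)"
    by (intro moduleI cring_base_field)
      (simp_all add: smult Const_add Const_mult ring_distribs mult.assoc)
  then show "gmodule base_field poly_Aut (Der_rep :: (('n, 'k::field) mpoly_map, 'k, ('n, 'k) mpoly_map) gmodule)"
  proof (intro gmodule.intro gmodule_axioms.intro group_poly_Aut)
    fix \<sigma> \<tau> \<delta> :: "('n, 'k) mpoly_map"
    assume st: "\<sigma> \<in> carrier poly_Aut" "\<tau> \<in> carrier poly_Aut"
    have "inv_into UNIV (\<sigma> \<circ> \<tau>) = inv_into UNIV \<tau> \<circ> inv_into UNIV \<sigma>"
      using st by (intro o_inv_distrib poly_AutD(1))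
    then show "gact Der_rep (\<sigma> \<otimes>\<^bsub>poly_Aut\<^esub> \<tau>) \<delta> = gact Der_rep \<sigma> (gact Der_rep \<tau> \<delta>)"
      by (simp add: conj_Der_def poly_Aut_def o_assoc)
  next
    show "gact Der_rep \<one>\<^bsub>poly_Aut\<^esub> \<delta> = \<delta>" for \<delta> :: "('n, 'k) mpoly_map"
      by (simp add: conj_Der_def poly_Aut_def)
  qed (auto simp: conj_Der_mem_poly_Der, simp_all add: conj_Der_def poly_AutD fun_eq_iff)
qed

lemma divergence_gmodule_hom:
  "(divergence :: ('n::finite, 'k::field) mpoly_map \<Rightarrow> _) \<in>
    gmodule_hom base_field poly_Aut Der_rep poly_rep"
proof (rule gmodule_homI)
  fix c :: 'k and \<sigma> \<delta> \<epsilon> :: "('n, 'k) mpoly_map"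
  assume d: "\<delta> \<in> carrier Der_rep"
  show "divergence (c \<odot>\<^bsub>Der_rep\<^esub> \<delta>) = c \<odot>\<^bsub>poly_rep\<^esub> divergence \<delta>"
    using Der_rep.smult_closed[of c \<delta>] d
    by (simp add: divergence_eq pderiv_mult sum_distrib_left)
  show "divergence (gact Der_rep \<sigma> \<delta>) = gact poly_rep \<sigma> (divergence \<delta>)" if "\<sigma> \<in> carrier poly_Aut"
    using that d by (simp add: divergence_conj_Der)
  show "divergence (\<delta> \<oplus>\<^bsub>Der_rep\<^esub> \<epsilon>) = divergence \<delta> \<oplus>\<^bsub>poly_rep\<^esub> divergence \<epsilon>" if "\<epsilon> \<in> carrier Der_rep"
    using Der_rep.M.a_closed[of \<delta> \<epsilon>] d that
    by (simp add: divergence_eq pderiv_add sum.distrib)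
qed simp

text \<open>A derivation with a single nonzero coefficient suffices: an antiderivative of
  \<open>q\<close> in one variable.\<close>

lemma divergence_surj: "divergence ` poly_Der = (UNIV :: ('n::finite, 'k::field_char_0) mpoly set)"
proof -
  have "q \<in> divergence ` poly_Der" for q :: "('n, 'k) mpoly"
  proof -
    obtain i :: 'n where True by blast
    obtain p where p: "pderiv i p = q" using pderiv_surj[of i q] by blast
    let ?d = "\<lambda>r. \<Sum>j\<in>UNIV. (if j = i then p else 0) * pderiv j r"
    have "divergence ?d = (\<Sum>j\<in>UNIV. if j = i then pderiv i p else 0)"
      unfolding divergence_def Der_coeffs_unique by (intro sum.cong) auto
    also have "\<dots> = q" by (simp add: p)
    finally have "q = divergence ?d" ..
    moreover have "?d \<in> poly_Der" by (rule sum_pderiv_mem_poly_Der)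
    ultimately show ?thesis by (rule image_eqI)
  qed
  then show ?thesis by blast
qed

theorem lemma2p22:
  assumes "CARD('n::finite) \<ge> 2"
  shows
    "(simple_gmodule base_field poly_Aut (poly_mod_const :: ('n, 'k::field_char_0) poly_quotient) \<and>
      algebra_isomorphic base_field
        (gmodule_End base_field poly_Aut (poly_mod_const :: ('n, 'k) poly_quotient))
        (ring_as_algebra base_field)) \<and>
     (\<exists>\<phi> \<in> gmodule_iso base_field poly_Aut
            (Der_mod_const_div :: ('n, 'k) Der_quotient) (poly_mod_const :: ('n, 'k) poly_quotient).
        \<forall>\<delta>\<in>poly_Der. \<phi> (const_div_Der +>\<^bsub>Der_rep\<^esub> \<delta>) = range Const +>\<^bsub>poly_rep\<^esub> divergence \<delta>) \<and>
     (simple_gmodule base_field poly_Aut (Der_mod_const_div :: ('n, 'k) Der_quotient) \<and>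
      algebra_isomorphic base_field
        (gmodule_End base_field poly_Aut (Der_mod_const_div :: ('n, 'k) Der_quotient))
        (ring_as_algebra base_field))"
proof -
  let ?P = "poly_mod_const :: ('n, 'k) poly_quotient" and ?D = "Der_mod_const_div :: ('n, 'k) Der_quotient"
  interpret P: simple_gmodule base_field poly_Aut ?P
    by (rule simple_poly_mod_const[OF assms])
  \<comment> \<open>Written as the full preimage of the constants, the derivations of constant
    divergence fit the hypotheses of \<open>gmodule_quotient_iso\<close>.\<close>
  have const_div: "const_div_Der = {\<delta> \<in> carrier Der_rep. divergence \<delta> \<in> range Const}"
    by (simp add: const_div_Der_def)
  have surj: "divergence ` carrier Der_rep = carrier (poly_rep :: (('n, 'k) mpoly_map, 'k, ('n, 'k) mpoly) gmodule)"
    by (simp add: divergence_surj)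
  note quot = gmodule_quotient_iso[OF Der_rep.gmodule poly_rep.gmodule gsubmodule_range_Const
      divergence_gmodule_hom surj const_div]
  have D: "gmodule base_field poly_Aut ?D"
    unfolding Der_mod_const_div_def by (rule Der_rep.gmodule_quotient[OF quot(1)])
  have iso: "(`) divergence \<in> gmodule_iso base_field poly_Aut ?D ?P"
    unfolding Der_mod_const_div_def poly_mod_const_def by (rule quot(2))
  interpret D: simple_gmodule base_field poly_Aut ?D
    by (rule simple_gmodule_iso[OF D P.simple_gmodule_axioms iso])
  note scalar = poly_mod_const_End_scalar[OF assms]
  have "algebra_isomorphic base_field (gmodule_End base_field poly_Aut ?P) (ring_as_algebra base_field)"
    by (rule gmodule_End_isomorphic_base[OF field_base_field P.gmodule P.nonzero scalar])
  moreover have "algebra_isomorphic base_field (gmodule_End base_field poly_Aut ?D) (ring_as_algebra base_field)"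
    by (rule gmodule_End_isomorphic_base[OF field_base_field D D.nonzero
          gmodule_hom_scalar_iso[OF D iso scalar]])
  moreover have "\<forall>\<delta>\<in>poly_Der. divergence ` (const_div_Der +>\<^bsub>Der_rep\<^esub> \<delta>) =
      range Const +>\<^bsub>poly_rep\<^esub> (divergence \<delta> :: ('n, 'k) mpoly)"
    using quot(3) by simp
  ultimately show ?thesis
    using P.simple_gmodule_axioms D.simple_gmodule_axioms iso by blast
qed

end
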